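(* Let $(a_k),(b_k)$ be sequences of positive integers and $(u_k),(v_k)$ sequences of integers ($k\ge1$) such that $u_{k+1}\ge u_k+a_k$ and $v_{k+1}\ge v_k+b_k$ for all $k$; $\frac{1}{a_k}\sum_{i=1}^{k-1}a_i\to0$ and $\frac1{b_k}\sum_{j=1}^{k-1}b_j\to0$ as $k\to\infty$; and, for some constant $C>0$, $a_k\ge Cu_{k-1}$ and $b_k\ge Cv_{k-1}$ for all $k\ge2$. Let $s_1<s_2<\cdots$ be the increasing enumeration of $\bigcup_{k\ge1}[u_k+1,u_k+a_k]$ and $t_1<t_2<\cdots$ the increasing enumeration of $\bigcup_{k\ge1}[v_k+1,v_k+b_k]$. Let $S,T$ be commuting invertible measure-preserving transformations of a probability space $(X,m)$, and let $$\mathcal{A}_{(M,N)}f=\frac1{MN}\sum_{m=1}^M\sum_{n=1}^N f\circ S^{s_m}\circ T^{t_n}.$$ Then the maximal function $\sup_{N\ge1}|\mathcal{A}_{(N,N)}f|$ is weak $(1,1)$ and strong $(p,p)$ for all $1<p<\infty$. Hence, if the $\mathbb{Z}^2$-action generated by $S$ and $T$ is ergodic, then for all $f\in L^1(X)$, $\lim_{N\to\infty}\mathcal{A}_{(N,N)}f(x)=\int_X f\,dm$ for almost every $x\in X$.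
   Context: Intervals $[a,b]$ denote sets of integers. Weak $(1,1)$ means there is a constant $K$ with $m\{x:\sup_N|\mathcal{A}_{(N,N)}f(x)|>\lambda\}\le\frac K\lambda\|f\|_1$ for all $f\in L^1(X)$, $\lambda>0$; strong $(p,p)$ means there is $K_p$ with $\|\sup_N|\mathcal{A}_{(N,N)}f|\|_p\le K_p\|f\|_p$ for all $f\in L^p(X)$. *)

theory Defs
  imports "HOL-Probability.Probability"
begin

definition invertible_measure_preserving :: "'a measure \<Rightarrow> ('a \<Rightarrow> 'a) \<Rightarrow> bool" where
  "invertible_measure_preserving M S \<longleftrightarrow>
     bij_betw S (space M) (space M) \<and>
     S \<in> measurable M M \<and>
     inv_into (space M) S \<in> measurable M M \<and>
     distr M M S = M"

definition int_iterate :: "'a measure \<Rightarrow> ('a \<Rightarrow> 'a) \<Rightarrow> int \<Rightarrow> 'a \<Rightarrow> 'a" where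
  "int_iterate M S i =
     (if i \<ge> 0 then S ^^ nat i else inv_into (space M) S ^^ nat (- i))"

definition ergodic_Z2_action :: "'a measure \<Rightarrow> ('a \<Rightarrow> 'a) \<Rightarrow> ('a \<Rightarrow> 'a) \<Rightarrow> bool" where
  "ergodic_Z2_action M S T \<longleftrightarrow>
     (\<forall>A \<in> sets M.
        (\<forall>i j. (int_iterate M S i \<circ> int_iterate M T j) -` A \<inter> space M = A) \<longrightarrow>
        measure M A = 0 \<or> measure M A = 1)"

text \<open>Sequences are indexed from 1; the value at index 0 is irrelevant throughout.\<close>

definition increasing_enumeration :: "(nat \<Rightarrow> int) \<Rightarrow> int set \<Rightarrow> bool" where
  "increasing_enumeration s A \<longleftrightarrow> strict_mono_on {1..} s \<and> s ` {1..} = A"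

definition block_union :: "(nat \<Rightarrow> int) \<Rightarrow> (nat \<Rightarrow> nat) \<Rightarrow> int set" where
  "block_union u a = (\<Union>k\<in>{1..}. {u k + 1..u k + int (a k)})"

definition double_average ::
  "'a measure \<Rightarrow> ('a \<Rightarrow> 'a) \<Rightarrow> ('a \<Rightarrow> 'a) \<Rightarrow> (nat \<Rightarrow> int) \<Rightarrow> (nat \<Rightarrow> int) \<Rightarrow>
   nat \<Rightarrow> nat \<Rightarrow> ('a \<Rightarrow> 'b::real_normed_vector) \<Rightarrow> 'a \<Rightarrow> 'b" where
  "double_average M S T s t m n f x =
     (1 / (real m * real n)) *\<^sub>R
       (\<Sum>i=1..m. \<Sum>j=1..n. (f \<circ> int_iterate M S (s i) \<circ> int_iterate M T (t j)) x)"

text \<open>The supremum may be infinite, so maximal functions take values in the extended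
  nonnegative reals.\<close>

definition square_maximal ::
  "'a measure \<Rightarrow> ('a \<Rightarrow> 'a) \<Rightarrow> ('a \<Rightarrow> 'a) \<Rightarrow> (nat \<Rightarrow> int) \<Rightarrow> (nat \<Rightarrow> int) \<Rightarrow>
   ('a \<Rightarrow> 'b::real_normed_vector) \<Rightarrow> 'a \<Rightarrow> ennreal" where
  "square_maximal M S T s t f x =
     (SUP n\<in>{1..}. ennreal (norm (double_average M S T s t n n f x)))"

definition ennreal_powr :: "ennreal \<Rightarrow> real \<Rightarrow> ennreal" where
  \<comment> \<open>only meant for positive exponents\<close>
  "ennreal_powr y p = (if y = \<infinity> then \<infinity> else ennreal (enn2real y powr p))"

definition Lp_norm :: "'a measure \<Rightarrow> real \<Rightarrow> ('a \<Rightarrow> ennreal) \<Rightarrow> ennreal" where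
  "Lp_norm M p g = ennreal_powr (\<integral>\<^sup>+x. ennreal_powr (g x) p \<partial>M) (1 / p)"

definition Lp_functions ::
  "'a measure \<Rightarrow> real \<Rightarrow> ('a \<Rightarrow> 'b::{real_normed_vector, second_countable_topology}) set" where
  "Lp_functions M p =
     {f \<in> borel_measurable M. Lp_norm M p (\<lambda>x. ennreal (norm (f x))) < \<infinity>}"

definition weak_type_1_1 ::
  "'a measure \<Rightarrow>
   (('a \<Rightarrow> 'b::{real_normed_vector, second_countable_topology}) \<Rightarrow> 'a \<Rightarrow> ennreal) \<Rightarrow> bool" where
  "weak_type_1_1 M Q \<longleftrightarrow>
     (\<exists>K::real. \<forall>f \<in> Lp_functions M 1. \<forall>l::real. l > 0 \<longrightarrow>
        emeasure M {x \<in> space M. Q f x > ennreal l}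
          \<le> ennreal (K / l) * Lp_norm M 1 (\<lambda>x. ennreal (norm (f x))))"

definition strong_type ::
  "'a measure \<Rightarrow> real \<Rightarrow>
   (('a \<Rightarrow> 'b::{real_normed_vector, second_countable_topology}) \<Rightarrow> 'a \<Rightarrow> ennreal) \<Rightarrow> bool" where
  "strong_type M p Q \<longleftrightarrow>
     (\<exists>K::real. \<forall>f \<in> Lp_functions M p.
        Lp_norm M p (Q f) \<le> ennreal K * Lp_norm M p (\<lambda>x. ennreal (norm (f x))))"

end

theory Submission
  imports Defs
begin

text \<open>
  The first \<open>N\<close> terms of \<open>s\<close> fill the blocks before some block \<open>k\<close> and an initial piece of block \<open>k\<close>.
  Since \<open>C * u (k - 2) \<le> a (k - 1) \<le> N\<close>, the blocks up to \<open>k - 2\<close> lie in a single interval of length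
  \<open>O(N)\<close>, and so do block \<open>k - 1\<close> and the piece of block \<open>k\<close>; hence the difference set of
  \<open>s ` {1..N}\<close> has \<open>O(N)\<close> elements. The sets \<open>F N = s ` {1..N} \<times> t ` {1..N}\<close> are therefore nested and
  satisfy \<open>|F N - F N| \<le> K * |F N|\<close>, so Vitali's covering argument on \<open>\<int>\<^sup>2\<close> and Calderon's transference
  give the weak \<open>(1,1)\<close> bound, and interpolation with the trivial \<open>L\<^sup>\<infinity>\<close> bound gives the strong ones. The number of
  blocks met is \<open>o(N)\<close>, because \<open>a\<close> tends to infinity by the ratio condition, so the \<open>F N\<close> form a
  Folner sequence. Convergence then follows from the maximal inequality, once every function of
  mean zero is replaced by one of small \<open>L\<^sup>1\<close> norm with asymptotically equal averages.
\<close>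

section \<open>Block sequences\<close>

definition difference_set :: "'g::ab_group_add set \<Rightarrow> 'g set" where
  "difference_set A = (\<lambda>(p, q). p - q) ` (A \<times> A)"

lemma finite_difference_set: "finite A \<Longrightarrow> finite (difference_set A)"
  by (simp add: difference_set_def)

lemma difference_set_Times_subset:
  "difference_set (A \<times> B) \<subseteq> difference_set A \<times> difference_set B"
  unfolding difference_set_def
proof (rule image_subsetI)
  fix z assume "z \<in> (A \<times> B) \<times> (A \<times> B)"
  then obtain p q p' q' where z: "z = ((p, q), (p', q'))" "(p, p') \<in> A \<times> A" "(q, q') \<in> B \<times> B"
    by auto
  have "(\<lambda>(p, q). p - q) (p, p') \<in> (\<lambda>(p, q). p - q) ` (A \<times> A)"
    "(\<lambda>(p, q). p - q) (q, q') \<in> (\<lambda>(p, q). p - q) ` (B \<times> B)"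
    by (intro imageI z)+
  then show "(case z of (p, q) \<Rightarrow> p - q) \<in> (\<lambda>(p, q). p - q) ` (A \<times> A) \<times> (\<lambda>(p, q). p - q) ` (B \<times> B)"
    by (simp add: z(1))
qed

text \<open>A point of the product that is not in the shifted product already fails in one
  coordinate. This reduces the Folner condition on the lattice to the two coordinate
  sequences.\<close>

lemma Times_diff_shift_subset:
  fixes i :: "'a::plus" and j :: "'b::plus"
  shows "A \<times> B - (+) (i, j) ` (A \<times> B) \<subseteq> (A - (+) i ` A) \<times> B \<union> A \<times> (B - (+) j ` B)"
proof
  fix z assume z: "z \<in> A \<times> B - (+) (i, j) ` (A \<times> B)"
  obtain x y where xy: "z = (x, y)" by fastforce
  have "\<not> (x \<in> (+) i ` A \<and> y \<in> (+) j ` B)"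
  proof
    assume "x \<in> (+) i ` A \<and> y \<in> (+) j ` B"
    then obtain x' y' where "x' \<in> A" "x = i + x'" "y' \<in> B" "y = j + y'" by blast
    then have "z = (i, j) + (x', y')" "(x', y') \<in> A \<times> B" by (simp_all add: xy)
    then show False using z by blast
  qed
  then show "z \<in> (A - (+) i ` A) \<times> B \<union> A \<times> (B - (+) j ` B)" using z xy by simp
qed

text \<open>Only points near one end of the interval are lost. The bound does not depend on the
  length, so in the Folner estimate every block costs the same.\<close>

lemma card_shifted_interval_diff:
  fixes l r m :: int
  shows "card {x \<in> {l..r}. x - m \<notin> {l..r}} \<le> nat \<bar>m\<bar>"
proof (cases "m \<ge> 0")
  case True
  have "{x \<in> {l..r}. x - m \<notin> {l..r}} \<subseteq> {l..<l + m}"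
    using True by auto
  then have "card {x \<in> {l..r}. x - m \<notin> {l..r}} \<le> card {l..<l + m}"
    by (intro card_mono) auto
  then show ?thesis using True by simp
next
  case False
  have "{x \<in> {l..r}. x - m \<notin> {l..r}} \<subseteq> {r + m<..r}"
    using False by auto
  then have "card {x \<in> {l..r}. x - m \<notin> {l..r}} \<le> card {r + m<..r}"
    by (intro card_mono) auto
  then show ?thesis using False by simp
qed

text \<open>Two intervals of length \<open>L\<close> starting at \<open>w\<close> and
  \<open>w'\<close> have all their differences in the \<open>2 * L\<close> integers around
  \<open>w - w'\<close>. For a bounded number of intervals the count is linear in \<open>L\<close>,
  wherever they lie.\<close>

lemma card_difference_set_intervals:
  fixes W :: "int set" and L :: nat
  assumes "finite W" and A: "A \<subseteq> (\<Union>w\<in>W. {w..<w + int L})"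
  shows "finite (difference_set A) \<and> card (difference_set A) \<le> card W * card W * (2 * L)"
proof -
  let ?I = "\<lambda>(w, w'). {w - w' - int L..<w - w' + int L}"
  have sub: "difference_set A \<subseteq> (\<Union>z\<in>W \<times> W. ?I z)"
  proof
    fix z assume "z \<in> difference_set A"
    then obtain p q where pq: "p \<in> A" "q \<in> A" "z = p - q"
      by (auto simp: difference_set_def)
    obtain w where w: "w \<in> W" "p \<in> {w..<w + int L}" using pq A by blast
    obtain w' where w': "w' \<in> W" "q \<in> {w'..<w' + int L}" using pq A by blast
    have "z \<in> ?I (w, w')" using w w' pq by auto
    then show "z \<in> (\<Union>z\<in>W \<times> W. ?I z)" using w(1) w'(1) by blast
  qed
  have fin: "finite (\<Union>z\<in>W \<times> W. ?I z)" using assms(1) by auto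
  have "card (difference_set A) \<le> card (\<Union>z\<in>W \<times> W. ?I z)"
    by (rule card_mono[OF fin sub])
  also have "\<dots> \<le> (\<Sum>z\<in>W \<times> W. card (?I z))"
    by (rule card_UN_le) (use assms in auto)
  also have "\<dots> = (\<Sum>z\<in>W \<times> W. 2 * L)"
    by (rule sum.cong) (auto simp: nat_mult_distrib)
  also have "\<dots> = card W * card W * (2 * L)" by (simp add: card_cartesian_product)
  finally show ?thesis using finite_subset[OF sub fin] by simp
qed

section \<open>Initial segments of a block sequence\<close>

locale block_enumeration =
  fixes a :: "nat \<Rightarrow> nat" and u s :: "nat \<Rightarrow> int" and C :: real
  assumes a_pos: "\<And>k. k \<ge> 1 \<Longrightarrow> a k > 0"
    and u_step: "\<And>k. k \<ge> 1 \<Longrightarrow> u (k + 1) \<ge> u k + int (a k)"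
    and a_ratio: "(\<lambda>k. (1 / real (a k)) * (\<Sum>i=1..k-1. real (a i))) \<longlonglongrightarrow> 0"
    and C_pos: "C > 0"
    and a_ge: "\<And>k. k \<ge> 2 \<Longrightarrow> real (a k) \<ge> C * real_of_int (u (k - 1))"
    and enum: "increasing_enumeration s (block_union u a)"
begin

abbreviation block :: "nat \<Rightarrow> int set" where
  "block k \<equiv> {u k + 1..u k + int (a k)}"

lemma block_le:
  assumes "1 \<le> i" "i < k" shows "u i + int (a i) \<le> u k"
  using \<open>i < k\<close>
proof (induction k)
  case (Suc k)
  show ?case
  proof (cases "i = k")
    case True then show ?thesis using u_step[of k] assms(1) by simp
  next
    case False
    then have "u i + int (a i) \<le> u k" using Suc by simp
    also have "\<dots> \<le> u (Suc k)" using u_step[of k] assms(1) False Suc.prems by simp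
    finally show ?thesis .
  qed
qed simp

lemma s_less_iff: "1 \<le> i \<Longrightarrow> 1 \<le> j \<Longrightarrow> s i < s j \<longleftrightarrow> i < j"
  using enum strict_mono_on_less[of "{1..}" s i j] unfolding increasing_enumeration_def
  by auto

lemma s_inj: "inj_on s {1..N}"
  by (metis atLeastAtMost_iff inj_onI less_irrefl linorder_neqE_nat s_less_iff)

lemma card_initial: "card (s ` {1..N}) = N"
  using card_image[OF s_inj] by simp

text \<open>The values up to \<open>s N\<close> in the enumerated set are exactly the first
  \<open>N\<close> ones, and the blocks are ordered from left to right. The two numerical bounds
  come from counting both sides of the decomposition.\<close>

lemma initial_blocks:
  assumes "N \<ge> 1"
  obtains k where "k \<ge> 1" "s N \<in> block k"
    "s ` {1..N} = (\<Union>i\<in>{1..<k}. block i) \<union> {u k + 1..s N}"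
    "(\<Sum>i=1..<k. a i) < N" "s N - u k \<le> int N"
proof -
  have range: "s ` {1..} = (\<Union>k\<in>{1..}. block k)"
    using enum by (simp add: increasing_enumeration_def block_union_def)
  then obtain k where k: "k \<ge> 1" "s N \<in> block k" using assms by blast
  have eq: "s ` {1..N} = (\<Union>i\<in>{1..<k}. block i) \<union> {u k + 1..s N}"
  proof
    show "s ` {1..N} \<subseteq> (\<Union>i\<in>{1..<k}. block i) \<union> {u k + 1..s N}"
    proof
      fix x assume "x \<in> s ` {1..N}"
      then obtain i where i: "1 \<le> i" "i \<le> N" "x = s i" by auto
      have le: "x \<le> s N" using s_less_iff[of N i] i assms by force
      obtain j where j: "j \<ge> 1" "x \<in> block j" using range i by blast
      have "\<not> k < j" using block_le[of k j] k j le by auto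
      then consider "j < k" | "j = k" by linarith
      then show "x \<in> (\<Union>i\<in>{1..<k}. block i) \<union> {u k + 1..s N}"
        using j le by cases auto
    qed
    show "(\<Union>i\<in>{1..<k}. block i) \<union> {u k + 1..s N} \<subseteq> s ` {1..N}"
    proof
      fix x assume x: "x \<in> (\<Union>i\<in>{1..<k}. block i) \<union> {u k + 1..s N}"
      have "x \<le> s N \<and> x \<in> (\<Union>k\<in>{1..}. block k)"
      proof (cases "x \<in> {u k + 1..s N}")
        case True then show ?thesis using k by auto
      next
        case False
        then obtain i where i: "1 \<le> i" "i < k" "x \<in> block i" using x by auto
        then show ?thesis using block_le[of i k] k by auto
      qed
      then have "x \<le> s N" "x \<in> s ` {1..}" unfolding range by auto
      then obtain i where i: "i \<ge> 1" "x = s i" "s i \<le> s N" by auto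
      then have "i \<le> N" using s_less_iff[of N i] assms by force
      then show "x \<in> s ` {1..N}" using i by auto
    qed
  qed
  have disj: "block i \<inter> block j = {}" if "1 \<le> i" "1 \<le> j" "i \<noteq> j" for i j
  proof -
    have "u i + int (a i) \<le> u j \<or> u j + int (a j) \<le> u i"
      using block_le[of i j] block_le[of j i] that by linarith
    then show ?thesis by (elim disjE) (simp_all add: disjoint_iff)
  qed
  have "card (\<Union>i\<in>{1..<k}. block i) = (\<Sum>i=1..<k. a i)"
  proof -
    have "\<forall>i\<in>{1..<k}. \<forall>j\<in>{1..<k}. i \<noteq> j \<longrightarrow> block i \<inter> block j = {}"
      by (intro ballI impI disj) auto
    then have "card (\<Union>i\<in>{1..<k}. block i) = (\<Sum>i=1..<k. card (block i))"
      by (intro card_UN_disjoint) auto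
    then show ?thesis by simp
  qed
  moreover have "(\<Union>i\<in>{1..<k}. block i) \<inter> {u k + 1..s N} = {}"
  proof -
    have "block i \<inter> {u k + 1..s N} = {}" if "i \<in> {1..<k}" for i
      using that block_le[of i k] by auto
    then show ?thesis by blast
  qed
  moreover have "finite (\<Union>i\<in>{1..<k}. block i)" by auto
  \<comment> \<open>The last term is at least 1, since \<open>s N\<close> lies in block
    \<open>k\<close>; this makes the bound on the complete blocks strict.\<close>
  ultimately have "N = (\<Sum>i=1..<k. a i) + nat (s N - u k)"
    using arg_cong[OF eq, of card] card_initial[of N] by (simp add: card_Un_disjoint)
  then have "(\<Sum>i=1..<k. a i) < N" "s N - u k \<le> int N" using k(2) by auto
  with k eq show thesis by (intro that)
qed

lemma initial_covered:
  obtains D :: nat where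
    "\<And>N. N \<ge> 1 \<Longrightarrow> \<exists>W. finite W \<and> card W \<le> 3 \<and> s ` {1..N} \<subseteq> (\<Union>w\<in>W. {w..<w + int (D * N)})"
proof
  \<comment> \<open>\<open>1 / C\<close> pays for \<open>u (k - 2)\<close>, the 2 for the length of
    a block and the half-open end, and \<open>\<bar>u 1\<bar>\<close> for a negative starting point
    \<open>u 1\<close>.\<close>
  define D where "D = nat \<lceil>1 / C\<rceil> + 2 + nat \<bar>u 1\<bar>"
  fix N :: nat assume N: "N \<ge> 1"
  obtain k where k: "k \<ge> 1" "s N \<in> block k"
    "s ` {1..N} = (\<Union>i\<in>{1..<k}. block i) \<union> {u k + 1..s N}"
    "(\<Sum>i=1..<k. a i) < N" "s N - u k \<le> int N"
    using initial_blocks[OF N] by blast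
  have a_le: "a i < N" if "i \<in> {1..<k}" for i
  proof -
    have "a i \<le> (\<Sum>i=1..<k. a i)" using that by (intro member_le_sum) auto
    then show ?thesis using k by simp
  qed
  have DN: "int N + 1 \<le> int (D * N)"
  proof -
    have "2 * N \<le> D * N" by (intro mult_right_mono) (auto simp: D_def)
    then show ?thesis using N by linarith
  qed
  \<comment> \<open>For \<open>k = 1\<close> the entry \<open>u (k - 1)\<close> is the arbitrary
    value \<open>u 0\<close>; it only adds a further interval, since then no complete block
    precedes.\<close>
  let ?W = "{u 1, u (k - 1), u k}"
  have "s ` {1..N} \<subseteq> (\<Union>w\<in>?W. {w..<w + int (D * N)})"
  proof
    fix x assume "x \<in> s ` {1..N}"
    then consider "x \<in> {u k + 1..s N}" | i where "i \<in> {1..<k}" "x \<in> block i"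
      using k(3) by auto
    then show "x \<in> (\<Union>w\<in>?W. {w..<w + int (D * N)})"
    proof cases
      case 1
      then have "x \<in> {u k..<u k + int (D * N)}" using k(5) DN by auto
      then show ?thesis by blast
    next
      case 2
      then have i: "1 \<le> i" "i < k" "x > u i" "x \<le> u i + int (a i)" by auto
      have ai: "a i < N" using a_le 2 by simp
      show ?thesis
      proof (cases "i = k - 1")
        case True
        then have "x \<in> {u (k-1)..<u (k-1) + int (D * N)}" using i ai DN by auto
        then show ?thesis by blast
      next
        case False
        then have ik: "i < k - 1" "k \<ge> 3" "k - 1 - 1 = k - 2" using i by auto
        \<comment> \<open>The growth condition is applied to block \<open>k - 1\<close>, the last
          complete one, whose length is already known to be below \<open>N\<close>.\<close>
        have "C * u (k - 2) \<le> a (k - 1)" using a_ge[of "k - 1"] ik by simp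
        also have "\<dots> \<le> N" using a_le[of "k - 1"] ik by simp
        finally have "u (k - 2) \<le> N * (1 / C)" using C_pos by (simp add: field_simps)
        also have "\<dots> \<le> N * real (nat \<lceil>1 / C\<rceil>)"
          by (intro mult_left_mono) (use C_pos in \<open>auto intro: real_nat_ceiling_ge\<close>)
        finally have "real_of_int (u (k - 2)) \<le> real_of_int (int (N * nat \<lceil>1 / C\<rceil>))"
          by (simp only: of_int_of_nat_eq of_nat_mult of_int_mult)
        then have uk: "u (k - 2) \<le> int (N * nat \<lceil>1 / C\<rceil>)" by (simp only: of_int_le_iff)
        have "u i \<le> u (k - 2)"
        proof (cases "i = k - 2")
          case False
          then have "u i + int (a i) \<le> u (k - 2)" using i ik by (intro block_le) auto
          then show ?thesis by linarith
        qed simp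
        with uk i ai have "x < int (N * nat \<lceil>1 / C\<rceil>) + int N" by linarith
        moreover have "- u 1 \<le> int (N * nat \<bar>u 1\<bar>)"
        proof -
          have "1 * \<bar>u 1\<bar> \<le> int N * \<bar>u 1\<bar>" using N by (intro mult_right_mono) auto
          then show ?thesis by simp
        qed
        moreover have "int (D * N) = int (N * nat \<lceil>1 / C\<rceil>) + 2 * int N + int (N * nat \<bar>u 1\<bar>)"
          by (simp add: D_def algebra_simps)
        ultimately have "x < u 1 + int (D * N)" by linarith
        moreover have "u 1 \<le> x"
          using block_le[of 1 i] i by (cases "i = 1") auto
        ultimately show ?thesis by auto
      qed
    qed
  qed
  moreover have "card ?W \<le> 3" by (auto simp: card_insert_if)
  moreover have "finite ?W" by simp
  ultimately show "\<exists>W. finite W \<and> card W \<le> 3 \<and> s ` {1..N} \<subseteq> (\<Union>w\<in>W. {w..<w + int (D * N)})"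
    by (intro exI[of _ ?W] conjI)
qed

lemma card_difference_set_initial:
  obtains K :: nat where "\<And>N. card (difference_set (s ` {1..N})) \<le> K * N"
proof -
  obtain D where D: "\<And>N. N \<ge> 1 \<Longrightarrow>
      \<exists>W. finite W \<and> card W \<le> 3 \<and> s ` {1..N} \<subseteq> (\<Union>w\<in>W. {w..<w + int (D * N)})"
    using initial_covered by blast
  \<comment> \<open>\<open>18 * D\<close> is 3 times 3 pairs of intervals with
    \<open>2 * D * N\<close> differences each.\<close>
  have "card (difference_set (s ` {1..N})) \<le> (18 * D) * N" for N
  proof (cases "N \<ge> 1")
    case True
    obtain W where W: "finite W" "card W \<le> 3" "s ` {1..N} \<subseteq> (\<Union>w\<in>W. {w..<w + int (D * N)})"
      using D[OF True] by blast
    have "card (difference_set (s ` {1..N})) \<le> card W * card W * (2 * (D * N))"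
      using card_difference_set_intervals[OF W(1,3)] by simp
    also have "\<dots> \<le> 3 * 3 * (2 * (D * N))"
      using W(2) by (intro mult_mono) auto
    finally show ?thesis by simp
  qed (simp add: difference_set_def)
  then show thesis by (rule that)
qed

text \<open>The sum in the ratio condition contains \<open>a 1\<close>, which is at least 1, so
  \<open>1 / a k\<close> is at most the ratio and tends to 0.\<close>

lemma a_at_top: "filterlim a at_top sequentially"
proof (rule filterlim_at_top[THEN iffD2], rule allI)
  fix Z :: nat
  have "\<forall>\<^sub>F k in sequentially. (1 / real (a k)) * (\<Sum>i=1..k-1. real (a i)) < 1 / real (Suc Z)"
    using order_tendstoD(2)[OF a_ratio, of "1 / real (Suc Z)"] by simp
  then show "\<forall>\<^sub>F k in sequentially. Z \<le> a k"
    using eventually_ge_at_top[of 2]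
  proof eventually_elim
    case (elim k)
    have "1 \<le> a 1" using a_pos[of 1] by simp
    also have "real (a 1) \<le> (\<Sum>i=1..k-1. real (a i))"
      using elim by (intro member_le_sum) auto
    finally have "1 \<le> (\<Sum>i=1..k-1. real (a i))" by simp
    then have "1 / real (a k) \<le> (1 / real (a k)) * (\<Sum>i=1..k-1. real (a i))"
      using mult_left_mono[of 1 "(\<Sum>i=1..k-1. real (a i))" "1 / real (a k)"] by simp
    also have "\<dots> < 1 / real (Suc Z)" using elim by simp
    finally show "Z \<le> a k" using a_pos[of k] elim by (simp add: field_simps)
  qed
qed

text \<open>The initial segment consists of \<open>k\<close> intervals, and the shift pushes at most
  \<open>\<bar>m\<bar>\<close> points out of each. It remains to see that \<open>k\<close> is small
  compared with \<open>N\<close>, which holds because all but finitely many blocks are long.\<close>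

lemma folner_initial:
  "(\<lambda>N. real (card (s ` {1..N} - (+) m ` s ` {1..N})) / real N) \<longlonglongrightarrow> 0"
proof (rule LIMSEQ_I)
  fix e :: real assume e: "e > 0"
  \<comment> \<open>Blocks from index \<open>j\<close> on have length at least \<open>Z\<close>, so
    the late ones contribute at most \<open>e * N / 2\<close>; \<open>N0\<close> gives the same
    bound for the first \<open>j + 1\<close> ones. Using \<open>\<bar>m\<bar> + 1\<close> keeps the
    factor positive for \<open>m = 0\<close>.\<close>
  define Z where "Z = nat \<lceil>2 * (\<bar>m\<bar> + 1) / e\<rceil>"
  have Z: "2 * (\<bar>m\<bar> + 1) / e \<le> Z" unfolding Z_def by (rule real_nat_ceiling_ge)
  have Z0: "0 < 2 * (\<bar>m\<bar> + 1) / e" using e by simp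
  obtain j where j: "\<And>i. i \<ge> j \<Longrightarrow> Z \<le> a i"
    using a_at_top unfolding filterlim_at_top eventually_sequentially by blast
  define N0 where "N0 = nat \<lceil>2 * (\<bar>m\<bar> + 1) * (j + 1) / e\<rceil> + 1"
  have "norm (real (card (s ` {1..N} - (+) m ` s ` {1..N})) / real N - 0) < e" if N: "N \<ge> N0" for N
  proof -
    have N1: "N \<ge> 1" using N by (simp add: N0_def)
    have "2 * (\<bar>m\<bar> + 1) * (j + 1) / e \<le> nat \<lceil>2 * (\<bar>m\<bar> + 1) * (j + 1) / e\<rceil>"
      by (rule real_nat_ceiling_ge)
    also have "\<dots> < N" using N by (simp add: N0_def)
    finally have Nj: "2 * (\<bar>m\<bar> + 1) * (j + 1) < e * N" using e by (simp add: field_simps)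
    obtain k where k: "k \<ge> 1" "s N \<in> block k"
      "s ` {1..N} = (\<Union>i\<in>{1..<k}. block i) \<union> {u k + 1..s N}"
      "(\<Sum>i=1..<k. a i) < N" "s N - u k \<le> int N"
      using initial_blocks[OF N1] by blast
    define I where "I i = (if i < k then block i else {u k + 1..s N})" for i
    have un: "s ` {1..N} = (\<Union>i\<in>{1..k}. I i)"
    proof -
      have "{1..k} = insert k {1..<k}" using k(1) by auto
      then show ?thesis using k(3) by (auto simp: I_def)
    qed
    have fin: "finite {x \<in> I i. x - m \<notin> I i}" for i by (auto simp: I_def)
    have "s ` {1..N} - (+) m ` s ` {1..N} \<subseteq> (\<Union>i\<in>{1..k}. {x \<in> I i. x - m \<notin> I i})"
    proof
      fix x assume x: "x \<in> s ` {1..N} - (+) m ` s ` {1..N}"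
      then obtain i where i: "i \<in> {1..k}" "x \<in> I i" using un by auto
      have "x - m \<notin> s ` {1..N}"
      proof
        assume "x - m \<in> s ` {1..N}"
        then have "m + (x - m) \<in> (+) m ` s ` {1..N}" by (rule imageI)
        then show False using x by simp
      qed
      then show "x \<in> (\<Union>i\<in>{1..k}. {x \<in> I i. x - m \<notin> I i})"
        using i un by blast
    qed
    then have "card (s ` {1..N} - (+) m ` s ` {1..N}) \<le> card (\<Union>i\<in>{1..k}. {x \<in> I i. x - m \<notin> I i})"
      using fin by (intro card_mono) auto
    also have "\<dots> \<le> (\<Sum>i\<in>{1..k}. card {x \<in> I i. x - m \<notin> I i})"
      by (rule card_UN_le) simp
    also have "\<dots> \<le> (\<Sum>i\<in>{1..k}. nat \<bar>m\<bar>)"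
      by (intro sum_mono) (auto simp only: I_def card_shifted_interval_diff split: if_splits)
    finally have c: "card (s ` {1..N} - (+) m ` s ` {1..N}) \<le> k * nat \<bar>m\<bar>" by simp
    \<comment> \<open>The blocks from \<open>j + 1\<close> to \<open>k - 1\<close> are complete and
      disjoint inside the first \<open>N\<close> terms, and each has at least \<open>Z\<close>
      elements.\<close>
    have "Z * (k - (j + 1)) \<le> N"
    proof -
      have "Z * (k - (j + 1)) = (\<Sum>i\<in>{j + 1..<k}. Z)" by simp
      also have "\<dots> \<le> (\<Sum>i\<in>{j + 1..<k}. a i)" by (intro sum_mono j) auto
      also have "\<dots> \<le> (\<Sum>i\<in>{1..<k}. a i)" by (intro sum_mono2) auto
      finally show ?thesis using k by simp
    qed
    then have "real (Z * (k - (j + 1))) \<le> N" by (simp only: of_nat_le_iff)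
    then have "real Z * real (k - (j + 1)) \<le> N" by simp
    moreover have "(2 * (\<bar>m\<bar> + 1) / e) * real (k - (j + 1)) \<le> real Z * real (k - (j + 1))"
      using Z by (intro mult_right_mono) auto
    ultimately have "(2 * (\<bar>m\<bar> + 1) / e) * real (k - (j + 1)) \<le> N" by linarith
    then have kj: "2 * (\<bar>m\<bar> + 1) * real (k - (j + 1)) \<le> e * N" using e by (simp add: field_simps)
    have "real k \<le> real (k - (j + 1)) + real (j + 1)" by linarith
    then have "2 * (\<bar>m\<bar> + 1) * real k \<le> 2 * (\<bar>m\<bar> + 1) * (real (k - (j + 1)) + real (j + 1))"
      by (intro mult_left_mono) auto
    also have "\<dots> = 2 * (\<bar>m\<bar> + 1) * real (k - (j + 1)) + 2 * (\<bar>m\<bar> + 1) * (j + 1)"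
      by (simp add: algebra_simps)
    also have "\<dots> < 2 * (e * N)" using kj Nj by simp
    finally have "2 * ((\<bar>m\<bar> + 1) * real k) < 2 * (e * N)" by (simp only: mult.assoc)
    then have "(\<bar>m\<bar> + 1) * real k < e * N" by (rule mult_left_less_imp_less) simp
    moreover have "real (k * nat \<bar>m\<bar>) \<le> (\<bar>m\<bar> + 1) * real k"
      by (simp add: algebra_simps)
    moreover have "real (card (s ` {1..N} - (+) m ` s ` {1..N})) \<le> real (k * nat \<bar>m\<bar>)"
      using c by (simp only: of_nat_le_iff)
    ultimately have "real (card (s ` {1..N} - (+) m ` s ` {1..N})) < e * N"
      by linarith
    then show ?thesis using N1 by (simp add: field_simps)
  qed
  then show "\<exists>no. \<forall>N\<ge>no. norm (real (card (s ` {1..N} - (+) m ` s ` {1..N})) / real N - 0) < e"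
    by (intro exI[of _ N0] allI impI)
qed

end

section \<open>The maximal inequality\<close>

text \<open>Vitali selection: taking a point of \<open>E\<close> with largest index \<open>n p\<close>, nestedness of \<open>F\<close>
  confines every point whose translate meets that of \<open>p\<close> to \<open>p\<close> plus the difference set.\<close>

lemma vitali_covering:
  fixes g :: "'g::ab_group_add \<Rightarrow> real" and F :: "nat \<Rightarrow> 'g set" and K l :: real
  assumes "finite E"
    and fin: "\<And>n. finite (F n)" and mono: "mono F"
    and doubling: "\<And>n. real (card (difference_set (F n))) \<le> K * real (card (F n))"
    and K: "K \<ge> 0" and l: "l \<ge> 0" and g: "\<And>p. g p \<ge> 0"
    and large: "\<And>p. p \<in> E \<Longrightarrow> l * card (F (n p)) \<le> (\<Sum>q\<in>F (n p). g (p + q))"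
    and nonempty: "\<And>p. p \<in> E \<Longrightarrow> F (n p) \<noteq> {}"
  shows "l * card E \<le> K * (\<Sum>z\<in>(\<Union>p\<in>E. (+) p ` F (n p)). g z)"
  using assms(1) large nonempty
proof (induction E rule: finite_psubset_induct)
  case (psubset E)
  show ?case
  proof (cases "E = {}")
    case False
    have "Max (n ` E) \<in> n ` E" using psubset.hyps False by (intro Max_in) auto
    then obtain p where p: "p \<in> E" "n p = Max (n ` E)" by auto
    then have np: "n p' \<le> n p" if "p' \<in> E" for p' using that psubset.hyps by simp
    define T where "T p = (+) p ` F (n p)" for p
    have finT: "finite (T p)" for p by (simp add: T_def fin)
    define E' where "E' = {p' \<in> E. T p' \<inter> T p = {}}"
    have "T p \<noteq> {}" using psubset.prems(2)[OF p(1)] by (simp add: T_def)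
    then have "E' \<subset> E" using p(1) by (auto simp: E'_def)
    then have IH: "l * card E' \<le> K * (\<Sum>z\<in>(\<Union>p\<in>E'. T p). g z)"
      unfolding T_def using psubset.prems by (intro psubset.IH) auto
    have "E - E' \<subseteq> (+) p ` difference_set (F (n p))"
    proof
      fix p' assume p': "p' \<in> E - E'"
      then obtain q q' where q: "q \<in> F (n p)" "q' \<in> F (n p')" "p' + q' = p + q"
        by (auto simp: E'_def T_def)
      have "q' \<in> F (n p)" using q np[of p'] p' monoD[OF mono] by blast
      then have "q - q' \<in> difference_set (F (n p))" using q by (auto simp: difference_set_def)
      moreover have "p' = p + (q - q')" using q by (simp add: algebra_simps eq_diff_eq)
      ultimately show "p' \<in> (+) p ` difference_set (F (n p))" by (rule rev_image_eqI)
    qed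
    then have "card (E - E') \<le> card ((+) p ` difference_set (F (n p)))"
      using fin by (intro card_mono) (auto intro: finite_difference_set)
    also have "\<dots> \<le> card (difference_set (F (n p)))"
      using fin by (intro card_image_le finite_difference_set)
    finally have "real (card (E - E')) \<le> K * card (F (n p))"
      using doubling[of "n p"] by linarith
    then have "l * card (E - E') \<le> l * (K * card (F (n p)))"
      using l by (intro mult_left_mono)
    also have "\<dots> = K * (l * card (F (n p)))" by simp
    also have "\<dots> \<le> K * (\<Sum>q\<in>F (n p). g (p + q))"
      using psubset.prems(1)[OF p(1)] K by (intro mult_left_mono)
    also have "(\<Sum>q\<in>F (n p). g (p + q)) = (\<Sum>z\<in>T p. g z)"
      unfolding T_def by (subst sum.reindex) (auto simp: inj_on_def)
    finally have 1: "l * card (E - E') \<le> K * (\<Sum>z\<in>T p. g z)" .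
    have "card E = card E' + card (E - E')"
    proof -
      have "finite E'" "card E' \<le> card E"
        using \<open>E' \<subset> E\<close> psubset.hyps by (auto intro: finite_subset card_mono)
      then show ?thesis using \<open>E' \<subset> E\<close> by (simp add: card_Diff_subset psubset_imp_subset)
    qed
    then have "l * card E = l * card E' + l * card (E - E')"
      by (simp add: algebra_simps)
    also have "\<dots> \<le> K * ((\<Sum>z\<in>(\<Union>p\<in>E'. T p). g z) + (\<Sum>z\<in>T p. g z))"
      using IH 1 by (simp add: algebra_simps)
    also have "(\<Sum>z\<in>(\<Union>p\<in>E'. T p). g z) + (\<Sum>z\<in>T p. g z) = (\<Sum>z\<in>(\<Union>p\<in>E'. T p) \<union> T p. g z)"
    proof (rule sum.union_disjoint[symmetric])
      show "finite (\<Union>p\<in>E'. T p)"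
        using finT psubset.hyps \<open>E' \<subset> E\<close> by (meson finite_UN finite_subset psubsetE)
      show "(\<Union>p\<in>E'. T p) \<inter> T p = {}" by (auto simp: E'_def)
    qed (rule finT)
    also have "K * \<dots> \<le> K * (\<Sum>z\<in>(\<Union>p\<in>E. T p). g z)"
      using p(1) g K finT psubset.hyps by (intro mult_left_mono sum_mono2) (auto simp: E'_def)
    finally show ?thesis by (simp add: T_def)
  qed simp
qed

text \<open>If \<open>F\<close> has coordinates at most \<open>H\<close> in absolute value, take a
  square of side \<open>2 * H + 1\<close>: its sum with \<open>F\<close> fits in a square of side
  \<open>4 * H + 1\<close>, less than twice as long. The factor 4 is the price of
  transference.\<close>

lemma int_pair_doubling_box:
  fixes F :: "(int \<times> int) set"
  assumes "finite F"
  obtains E where "finite E" "E \<noteq> {}" "card (\<Union>p\<in>E. (+) p ` F) \<le> 4 * card E"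
proof
  define H where "H = nat (Max (insert 0 ((\<lambda>(i, j). max \<bar>i\<bar> \<bar>j\<bar>) ` F)))"
  have H: "\<bar>i\<bar> \<le> H \<and> \<bar>j\<bar> \<le> H" if "(i, j) \<in> F" for i j
  proof -
    have "max \<bar>i\<bar> \<bar>j\<bar> \<le> Max (insert 0 ((\<lambda>(i, j). max \<bar>i\<bar> \<bar>j\<bar>) ` F))"
      using that assms by (intro Max_ge) force+
    also have "\<dots> \<le> int H" unfolding H_def by linarith
    finally show ?thesis by simp
  qed
  define E where "E = {0..2 * int H} \<times> {0..2 * int H}"
  show "finite E" "E \<noteq> {}" by (auto simp: E_def)
  have sub: "(\<Union>p\<in>E. (+) p ` F) \<subseteq> {- int H..3 * int H} \<times> {- int H..3 * int H}"
    using H by (fastforce simp: E_def abs_le_iff)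
  then have "card (\<Union>p\<in>E. (+) p ` F) \<le> card ({- int H..3 * int H} \<times> {- int H..3 * int H})"
    by (intro card_mono) auto
  also have "\<dots> = (4 * H + 1) * (4 * H + 1)"
    by (simp add: card_cartesian_product nat_add_distrib nat_mult_distrib flip: of_nat_Suc)
  also have "\<dots> \<le> 4 * ((2 * H + 1) * (2 * H + 1))"
    by (simp add: algebra_simps)
  also have "\<dots> = 4 * card E"
    by (simp add: E_def card_cartesian_product nat_add_distrib nat_mult_distrib)
  finally show "card (\<Union>p\<in>E. (+) p ` F) \<le> 4 * card E" .
qed

section \<open>Averages of a measure-preserving action of the integer lattice\<close>

locale Z2_averages = prob_space M for M :: "'a measure" +
  fixes act :: "int \<times> int \<Rightarrow> 'a \<Rightarrow> 'a" and F :: "nat \<Rightarrow> (int \<times> int) set" and K :: real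
  assumes act_measurable [measurable]: "\<And>p. act p \<in> measurable M M"
    and act_distr: "\<And>p. distr M M (act p) = M"
    and act_add: "\<And>p q x. x \<in> space M \<Longrightarrow> act (p + q) x = act p (act q x)"
    and F_finite: "\<And>n. finite (F n)"
    and F_mono: "mono F"
    and F_doubling: "\<And>n. real (card (difference_set (F n))) \<le> K * real (card (F n))"
    and K_nonneg: "K \<ge> 0"
begin

text \<open>For empty \<open>F n\<close> the value is 0, by division by zero; this occurs for
  \<open>F 0\<close> in the application.\<close>

definition avg :: "nat \<Rightarrow> ('a \<Rightarrow> real) \<Rightarrow> 'a \<Rightarrow> real" where
  "avg n f x = (\<Sum>p\<in>F n. f (act p x)) / card (F n)"

lemma act_space: "x \<in> space M \<Longrightarrow> act p x \<in> space M"
  using measurable_space[OF act_measurable] .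

lemma avg_measurable [measurable]:
  assumes [measurable]: "f \<in> borel_measurable M" shows "avg n f \<in> borel_measurable M"
  unfolding avg_def by measurable

lemma integral_act:
  fixes f :: "'a \<Rightarrow> real"
  assumes "f \<in> borel_measurable M"
  shows "(LINT x|M. f (act p x)) = (LINT x|M. f x)"
  using integral_distr[OF act_measurable assms, of p] by (simp add: act_distr)

lemma integrable_act:
  fixes f :: "'a \<Rightarrow> real"
  assumes "integrable M f"
  shows "integrable M (\<lambda>x. f (act p x))"
  using integrable_distr[OF act_measurable, of p f] assms by (simp add: act_distr)

text \<open>Calderon transference: the covering lemma is applied along the orbit of each point,
  on a box that is large compared with \<open>F R\<close>.\<close>

lemma truncated_maximal_inequality:
  assumes f: "integrable M f" "\<And>x. x \<in> space M \<Longrightarrow> f x \<ge> 0" and l: "l > 0"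
  shows "measure M {x \<in> space M. \<exists>n\<le>R. avg n f x > l} \<le> 4 * K / l * (LINT x|M. f x)"
proof -
  note [measurable] = borel_measurable_integrable[OF f(1)]
  define B where "B = {x \<in> space M. \<exists>n\<le>R. avg n f x > l}"
  have B [measurable]: "B \<in> sets M" unfolding B_def by measurable
  obtain E where E: "finite E" "E \<noteq> {}" "card (\<Union>p\<in>E. (+) p ` F R) \<le> 4 * card E"
    using int_pair_doubling_box[OF F_finite] .
  define U where "U = (\<Union>p\<in>E. (+) p ` F R)"
  have finU: "finite U" using E F_finite by (auto simp: U_def)
  \<comment> \<open>The pointwise form: on the orbit of \<open>x\<close>, covering bounds the number
    of bad points indexed by the box by the mass of \<open>f\<close> on the enlarged box
    \<open>U\<close>.\<close>
  have pw: "l * (\<Sum>p\<in>E. indicator B (act p x)) \<le> K * (\<Sum>z\<in>U. f (act z x))" if x: "x \<in> space M" for x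
  proof -
    define E' where "E' = {p \<in> E. act p x \<in> B}"
    have "\<forall>p. \<exists>n. p \<in> E' \<longrightarrow> n \<le> R \<and> avg n f (act p x) > l"
      by (auto simp: E'_def B_def)
    then obtain n where n: "\<And>p. p \<in> E' \<Longrightarrow> n p \<le> R \<and> avg (n p) f (act p x) > l" by metis
    have ne: "F (n p) \<noteq> {}" if "p \<in> E'" for p
      using n[OF that] l by (auto simp: avg_def)
    have "l * card E' \<le> K * (\<Sum>z\<in>(\<Union>p\<in>E'. (+) p ` F (n p)). f (act z x))"
    proof (rule vitali_covering[where F = F, OF _ F_finite F_mono F_doubling K_nonneg])
      show "finite E'" using E by (simp add: E'_def)
      show "0 \<le> f (act p x)" for p using f act_space x by blast
      show "F (n p) \<noteq> {}" if "p \<in> E'" for p using ne[OF that] .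
      show "l * card (F (n p)) \<le> (\<Sum>q\<in>F (n p). f (act (p + q) x))" if p: "p \<in> E'" for p
      proof -
        have "card (F (n p)) > 0" using ne[OF p] F_finite by (simp add: card_gt_0_iff)
        then have "l * card (F (n p)) \<le> (\<Sum>q\<in>F (n p). f (act q (act p x)))"
          using n[OF p] by (simp add: avg_def field_simps)
        also have "\<dots> = (\<Sum>q\<in>F (n p). f (act (p + q) x))"
          using act_add[OF x] by (simp add: add.commute)
        finally show ?thesis .
      qed
    qed (use l in auto)
    also have "\<dots> \<le> K * (\<Sum>z\<in>U. f (act z x))"
    proof (intro mult_left_mono sum_mono2 finU K_nonneg)
      show "(\<Union>p\<in>E'. (+) p ` F (n p)) \<subseteq> U"
        unfolding U_def
      proof (intro UN_mono image_mono)
        show "E' \<subseteq> E" by (auto simp: E'_def)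
        show "F (n p) \<subseteq> F R" if "p \<in> E'" for p using n[OF that] monoD[OF F_mono] by blast
      qed
      show "0 \<le> f (act b x)" for b using f act_space x by blast
    qed
    also have "real (card E') = (\<Sum>p\<in>E. indicator B (act p x))"
      using E(1) by (simp add: E'_def indicator_def sum.If_cases Int_def)
    finally show ?thesis by simp
  qed
  have intB: "integrable M (\<lambda>x. indicator B (act p x) :: real)" for p
    by (rule integrable_act) (auto intro!: integrable_real_indicator simp: less_top[symmetric])
  \<comment> \<open>After integration invariance makes every translate contribute equally, so only
    the ratio of \<open>card U\<close> to \<open>card E\<close> remains.\<close>
  have "l * (card E * measure M B) = (LINT x|M. l * (\<Sum>p\<in>E. indicator B (act p x)))"
    using intB integral_act[of "indicator B"] by (simp add: Bochner_Integration.integral_sum)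
  also have "\<dots> \<le> (LINT x|M. K * (\<Sum>z\<in>U. f (act z x)))"
    using intB integrable_act[OF f(1)] pw by (intro integral_mono) auto
  also have "\<dots> = K * (card U * (LINT x|M. f x))"
    using integrable_act[OF f(1)] integral_act[of f]
    by (simp add: Bochner_Integration.integral_sum)
  also have "\<dots> \<le> K * ((4 * card E) * (LINT x|M. f x))"
  proof -
    have "real (card U) \<le> real (4 * card E)" using E(3) unfolding U_def by (simp only: of_nat_le_iff)
    moreover have "0 \<le> (LINT x|M. f x)" using f by (intro integral_nonneg_AE) auto
    ultimately show ?thesis using K_nonneg by (intro mult_left_mono mult_right_mono) auto
  qed
  finally have "card E * (l * measure M B) \<le> card E * (4 * K * (LINT x|M. f x))"
    by (simp add: algebra_simps)
  moreover have "0 < real (card E)" using E by (simp add: card_gt_0_iff)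
  ultimately have "l * measure M B \<le> 4 * K * (LINT x|M. f x)"
    by (simp only: mult_le_cancel_left_pos)
  then show ?thesis using l by (simp add: B_def field_simps)
qed

text \<open>The truncated sets increase to the full one and their bound is uniform in
  \<open>R\<close>. Truncation was there because the box is chosen for a single largest set
  \<open>F R\<close>.\<close>

lemma maximal_inequality:
  assumes f: "integrable M f" "\<And>x. x \<in> space M \<Longrightarrow> f x \<ge> 0" and l: "l > 0"
  shows "measure M {x \<in> space M. \<exists>n. avg n f x > l} \<le> 4 * K / l * (LINT x|M. f x)"
proof (rule LIMSEQ_le_const2)
  note [measurable] = borel_measurable_integrable[OF f(1)]
  have "(\<lambda>R. measure M {x \<in> space M. \<exists>n\<le>R. avg n f x > l})
      \<longlonglongrightarrow> measure M (\<Union>R. {x \<in> space M. \<exists>n\<le>R. avg n f x > l})"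
    by (rule finite_Lim_measure_incseq) (auto simp: incseq_def intro: le_trans)
  also have "(\<Union>R. {x \<in> space M. \<exists>n\<le>R. avg n f x > l}) = {x \<in> space M. \<exists>n. avg n f x > l}"
    by auto
  finally show "(\<lambda>R. measure M {x \<in> space M. \<exists>n\<le>R. avg n f x > l})
      \<longlonglongrightarrow> measure M {x \<in> space M. \<exists>n. avg n f x > l}" .
  show "\<exists>N. \<forall>R\<ge>N. measure M {x \<in> space M. \<exists>n\<le>R. avg n f x > l} \<le> 4 * K / l * (LINT x|M. f x)"
    by (intro exI allI impI truncated_maximal_inequality f l)
qed

end

section \<open>Interpolation\<close>

lemma ennreal_powr_1 [simp]: "ennreal_powr y 1 = y"
  by (cases y) (auto simp: ennreal_powr_def)

lemma ennreal_powr_ennreal: "r \<ge> 0 \<Longrightarrow> ennreal_powr (ennreal r) p = ennreal (r powr p)"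
  by (simp add: ennreal_powr_def)

lemma ennreal_powr_mono: "p \<ge> 0 \<Longrightarrow> x \<le> y \<Longrightarrow> ennreal_powr x p \<le> ennreal_powr y p"
  by (cases x; cases y) (auto simp: ennreal_powr_def top_unique intro: powr_mono2 ennreal_leI)

lemma ennreal_powr_measurable [measurable]:
  "(\<lambda>y. ennreal_powr y p) \<in> borel_measurable borel"
  unfolding ennreal_powr_def by measurable

lemma Lp_norm_1: "Lp_norm M 1 g = (\<integral>\<^sup>+x. g x \<partial>M)"
  by (simp add: Lp_norm_def)

lemma Lp_functions_iff:
  assumes "p > 0"
  shows "f \<in> Lp_functions M p \<longleftrightarrow>
    f \<in> borel_measurable M \<and> (\<integral>\<^sup>+x. ennreal (norm (f x) powr p) \<partial>M) < \<infinity>"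
  by (auto simp: Lp_functions_def Lp_norm_def ennreal_powr_def less_top)

text \<open>On a probability space the bound \<open>norm (f x) \<le> 1 + norm (f x) powr p\<close>
  suffices; it makes the \<open>L\<^sup>1\<close> maximal inequality available for every
  \<open>p\<close>.\<close>

lemma (in prob_space) Lp_functions_integrable:
  assumes f: "f \<in> Lp_functions M p" and p: "p \<ge> 1"
  shows "integrable M (\<lambda>x. norm (f x))"
proof (rule integrableI_bounded)
  have f': "f \<in> borel_measurable M" "(\<integral>\<^sup>+x. ennreal (norm (f x) powr p) \<partial>M) < \<infinity>"
    using f p by (auto simp: Lp_functions_iff)
  then show "(\<lambda>x. norm (f x)) \<in> borel_measurable M" by measurable
  have le: "norm (f x) \<le> 1 + norm (f x) powr p" for x
  proof (cases "norm (f x) \<ge> 1")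
    case True
    then have "norm (f x) powr 1 \<le> norm (f x) powr p" using p by (intro powr_mono)
    then show ?thesis using True by simp
  qed (simp add: add_increasing2)
  then have "(\<integral>\<^sup>+x. norm (norm (f x)) \<partial>M) \<le> (\<integral>\<^sup>+x. 1 + ennreal (norm (f x) powr p) \<partial>M)"
  proof (intro nn_integral_mono)
    fix x
    have "ennreal (1 + norm (f x) powr p) = 1 + ennreal (norm (f x) powr p)"
      by (simp add: ennreal_plus)
    then show "ennreal (norm (norm (f x))) \<le> 1 + ennreal (norm (f x) powr p)"
      using ennreal_leI[OF le[of x]] by simp
  qed
  also have "\<dots> = 1 + (\<integral>\<^sup>+x. ennreal (norm (f x) powr p) \<partial>M)"
    using f'(1) by (subst nn_integral_add) (auto simp: emeasure_space_1)
  also have "\<dots> < \<infinity>" using f'(2) by simp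
  finally show "(\<integral>\<^sup>+x. norm (norm (f x)) \<partial>M) < \<infinity>" .
qed

text \<open>Used with exponent \<open>p - 1\<close> for the layer-cake formula and
  \<open>p - 2\<close> for interpolation; the latter is above -1 exactly because
  \<open>p > 1\<close>.\<close>

lemma nn_integral_powr_from_0:
  fixes D a c :: real
  assumes "D \<ge> 0" "a > -1" "c \<ge> 0"
  shows "(\<integral>\<^sup>+l. ennreal (if 0 < l \<and> l < c then D * l powr a else 0) \<partial>lborel)
    = ennreal (D * (c powr (a + 1) / (a + 1)))"
proof -
  have "((\<lambda>l. if l \<in> {0..c} then D * l powr a else 0) has_integral D * (c powr (a + 1) / (a + 1))) UNIV"
    unfolding has_integral_restrict_UNIV
    by (intro has_integral_mult_right has_integral_powr_from_0 assms)
  then have "(\<integral>\<^sup>+l. ennreal (if l \<in> {0..c} then D * l powr a else 0) \<partial>lborel)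
      = ennreal (D * (c powr (a + 1) / (a + 1)))"
    by (intro nn_integral_has_integral_lborel) (use assms in auto)
  moreover have "(\<integral>\<^sup>+l. ennreal (if 0 < l \<and> l < c then D * l powr a else 0) \<partial>lborel)
      = (\<integral>\<^sup>+l. ennreal (if l \<in> {0..c} then D * l powr a else 0) \<partial>lborel)"
    using AE_lborel_singleton[of "0::real"] AE_lborel_singleton[of c]
    by (intro nn_integral_cong_AE, eventually_elim) auto
  ultimately show ?thesis by simp
qed

text \<open>For finite \<open>y\<close> this is the integral of the derivative of the power; for
  infinite \<open>y\<close> the right side dominates every finite power and is therefore
  infinite.\<close>

lemma ennreal_powr_le_layer_cake:
  fixes y :: ennreal and p :: real
  assumes p: "p > 0"
  shows "ennreal_powr y p
    \<le> (\<integral>\<^sup>+l. ennreal (if 0 < l \<and> ennreal l < y then p * l powr (p - 1) else 0) \<partial>lborel)"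
proof (cases y)
  case (real r)
  have "(\<integral>\<^sup>+l. ennreal (if 0 < l \<and> ennreal l < y then p * l powr (p - 1) else 0) \<partial>lborel)
      = (\<integral>\<^sup>+l. ennreal (if 0 < l \<and> l < r then p * l powr (p - 1) else 0) \<partial>lborel)"
    using real by (intro nn_integral_cong) (auto simp: ennreal_less_iff)
  also have "\<dots> = ennreal (r powr p)"
    using nn_integral_powr_from_0[of p "p - 1" r] p real by simp
  finally show ?thesis using real by (simp add: ennreal_powr_ennreal)
next
  case top
  have le: "ennreal (c powr p)
      \<le> (\<integral>\<^sup>+l. ennreal (if 0 < l \<and> ennreal l < y then p * l powr (p - 1) else 0) \<partial>lborel)" (is "_ \<le> ?I")
    if "c \<ge> 0" for c
  proof -
    have "ennreal (c powr p) = (\<integral>\<^sup>+l. ennreal (if 0 < l \<and> l < c then p * l powr (p - 1) else 0) \<partial>lborel)"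
      using nn_integral_powr_from_0[of p "p - 1" c] p that by simp
    also have "\<dots> \<le> ?I"
      using top p by (intro nn_integral_mono) (auto intro!: ennreal_leI)
    finally show ?thesis .
  qed
  have "?I = \<top>"
  proof (cases ?I)
    case (real r)
    \<comment> \<open>If the integral had a finite value \<open>r\<close>, the bound at
      \<open>c = (r + 1) powr (1 / p)\<close> would exceed it.\<close>
    then have "ennreal (r + 1) \<le> ennreal r"
      using le[of "(r + 1) powr (1 / p)"] p by (simp add: powr_powr)
    then show ?thesis using real by (simp add: ennreal_le_iff)
  qed
  then show ?thesis by simp
qed

text \<open>The hypothesis is what the weak bound yields after cutting \<open>f\<close> at half the
  level. Integrating it against \<open>p * l powr (p - 2)\<close> and exchanging integrals leaves,
  for each \<open>x\<close>, the integral of \<open>l powr (p - 2)\<close> up to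
  \<open>2 * f x\<close>, whence the constant.\<close>

lemma (in sigma_finite_measure) marcinkiewicz_1_infinity:
  fixes f :: "'a \<Rightarrow> real" and g :: "'a \<Rightarrow> ennreal" and A p :: real
  assumes [measurable]: "f \<in> borel_measurable M" "g \<in> borel_measurable M"
    and f: "\<And>x. f x \<ge> 0" and A: "A \<ge> 0" and p: "p > 1"
    and weak: "\<And>l. l > 0 \<Longrightarrow> ennreal l * emeasure M {x \<in> space M. g x > ennreal l}
      \<le> ennreal A * (\<integral>\<^sup>+x. ennreal (if f x > l / 2 then f x else 0) \<partial>M)"
  shows "(\<integral>\<^sup>+x. ennreal_powr (g x) p \<partial>M)
    \<le> ennreal (A * p / (p - 1) * 2 powr (p - 1)) * (\<integral>\<^sup>+x. ennreal (f x powr p) \<partial>M)"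
proof -
  interpret pair_sigma_finite M lborel by unfold_locales
  let ?h = "\<lambda>x l. ennreal (if 0 < l \<and> ennreal l < g x then p * l powr (p - 1) else 0)"
  let ?k = "\<lambda>x l. ennreal (if 0 < l \<and> l < 2 * f x then (A * p * f x) * l powr (p - 2) else 0)"
  have "(\<integral>\<^sup>+x. ennreal_powr (g x) p \<partial>M) \<le> (\<integral>\<^sup>+x. (\<integral>\<^sup>+l. ?h x l \<partial>lborel) \<partial>M)"
    using p by (intro nn_integral_mono ennreal_powr_le_layer_cake) auto
  also have "\<dots> = (\<integral>\<^sup>+l. (\<integral>\<^sup>+x. ?h x l \<partial>M) \<partial>lborel)"
    by (rule Fubini'[symmetric]) measurable
  also have "\<dots> \<le> (\<integral>\<^sup>+l. (\<integral>\<^sup>+x. ?k x l \<partial>M) \<partial>lborel)"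
  proof (rule nn_integral_mono)
    fix l :: real
    show "(\<integral>\<^sup>+x. ?h x l \<partial>M) \<le> (\<integral>\<^sup>+x. ?k x l \<partial>M)"
    proof (cases "l > 0")
      case True
      have "(\<integral>\<^sup>+x. ?h x l \<partial>M)
          = (\<integral>\<^sup>+x. ennreal (p * l powr (p - 1)) * indicator {x \<in> space M. g x > ennreal l} x \<partial>M)"
        using True by (intro nn_integral_cong) (auto simp: indicator_def)
      also have "\<dots> = ennreal (p * l powr (p - 1)) * emeasure M {x \<in> space M. g x > ennreal l}"
        by (rule nn_integral_cmult_indicator) measurable
      \<comment> \<open>One factor \<open>l\<close> is split off to match the left side of the weak
        bound.\<close>
      also have "ennreal (p * l powr (p - 1)) = ennreal (p * l powr (p - 2)) * ennreal l"
      proof -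
        have "p * l powr (p - 1) = (p * l powr (p - 2)) * l"
          using True powr_add[of l "p - 2" 1] by simp
        then show ?thesis using True p by (simp add: ennreal_mult mult.assoc)
      qed
      also have "\<dots> * emeasure M {x \<in> space M. g x > ennreal l}
          \<le> ennreal (p * l powr (p - 2)) * (ennreal A * (\<integral>\<^sup>+x. ennreal (if f x > l / 2 then f x else 0) \<partial>M))"
        unfolding mult.assoc by (intro mult_left_mono weak True) simp
      also have "\<dots> = (\<integral>\<^sup>+x. ennreal (p * l powr (p - 2) * A) * ennreal (if f x > l / 2 then f x else 0) \<partial>M)"
        using p A by (subst nn_integral_cmult) (auto simp: ennreal_mult mult.assoc)
      also have "\<dots> = (\<integral>\<^sup>+x. ?k x l \<partial>M)"
        using p A f True
        by (intro nn_integral_cong) (auto simp: ennreal_mult[symmetric] mult_ac)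
      finally show ?thesis .
    qed simp
  qed
  also have "\<dots> = (\<integral>\<^sup>+x. (\<integral>\<^sup>+l. ?k x l \<partial>lborel) \<partial>M)"
    by (rule Fubini') measurable
  also have "\<dots> = (\<integral>\<^sup>+x. ennreal (A * p / (p - 1) * 2 powr (p - 1)) * ennreal (f x powr p) \<partial>M)"
  proof (rule nn_integral_cong)
    fix x
    have fp: "f x * f x powr (p - 1) = f x powr p"
      using f[of x] by (cases "f x = 0") (auto simp: powr_mult_base)
    have "(\<integral>\<^sup>+l. ?k x l \<partial>lborel) = ennreal ((A * p * f x) * ((2 * f x) powr (p - 2 + 1) / (p - 2 + 1)))"
      using f[of x] A p by (intro nn_integral_powr_from_0) auto
    also have "(A * p * f x) * ((2 * f x) powr (p - 2 + 1) / (p - 2 + 1))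
        = A * p / (p - 1) * 2 powr (p - 1) * (f x * f x powr (p - 1))"
      using f[of x] by (simp add: powr_mult field_simps)
    also have "ennreal \<dots> = ennreal (A * p / (p - 1) * 2 powr (p - 1)) * ennreal (f x powr p)"
      unfolding fp using A p by (intro ennreal_mult) auto
    finally show "(\<integral>\<^sup>+l. ?k x l \<partial>lborel) = \<dots>" .
  qed
  also have "\<dots> = ennreal (A * p / (p - 1) * 2 powr (p - 1)) * (\<integral>\<^sup>+x. ennreal (f x powr p) \<partial>M)"
    by (rule nn_integral_cmult) measurable
  finally show ?thesis .
qed

section \<open>Strong bounds for the averages\<close>

context Z2_averages
begin

lemma avg_mono: "(\<And>x. x \<in> space M \<Longrightarrow> f x \<le> g x) \<Longrightarrow> x \<in> space M \<Longrightarrow> avg n f x \<le> avg n g x"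
  unfolding avg_def by (intro divide_right_mono sum_mono) (auto simp: act_space)

lemma avg_add: "avg n (\<lambda>x. f x + g x) x = avg n f x + avg n g x"
  by (simp add: avg_def sum.distrib add_divide_distrib)

lemma avg_diff: "avg n (\<lambda>x. f x - g x) x = avg n f x - avg n g x"
  by (simp add: avg_def sum_subtractf diff_divide_distrib)

lemma avg_cmult: "avg n (\<lambda>x. c * f x) x = c * avg n f x"
  by (simp add: avg_def sum_distrib_left)

lemma avg_const: "F n \<noteq> {} \<Longrightarrow> avg n (\<lambda>x. c) x = c"
  using F_finite by (simp add: avg_def)

lemma abs_avg_le: "\<bar>avg n f x\<bar> \<le> avg n (\<lambda>x. \<bar>f x\<bar>) x"
  unfolding avg_def by (simp add: abs_divide divide_right_mono)

text \<open>The part of \<open>f\<close> below \<open>l / 2\<close> has averages at most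
  \<open>l / 2\<close>, so an average above \<open>l\<close> forces one of the remaining part
  \<open>f'\<close> above \<open>l / 2\<close>. The weak bound at level \<open>l / 2\<close> turns
  \<open>4 * K\<close> into \<open>8 * K\<close>.\<close>

lemma maximal_strong_type:
  assumes f: "integrable M f" "\<And>x. f x \<ge> 0" and p: "p > 1"
  shows "(\<integral>\<^sup>+x. ennreal_powr (SUP n. ennreal (avg n f x)) p \<partial>M)
    \<le> ennreal (8 * K * p / (p - 1) * 2 powr (p - 1)) * (\<integral>\<^sup>+x. ennreal (f x powr p) \<partial>M)"
proof (rule marcinkiewicz_1_infinity)
  note [measurable] = borel_measurable_integrable[OF f(1)]
  fix l :: real assume l: "l > 0"
  define f' where "f' x = (if f x > l / 2 then f x else 0)" for x
  have f'_meas [measurable]: "f' \<in> borel_measurable M" unfolding f'_def by measurable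
  have f': "integrable M f'"
    by (rule Bochner_Integration.integrable_bound[OF f(1)]) (auto simp: f'_def f(2))
  have "{x \<in> space M. (SUP n. ennreal (avg n f x)) > ennreal l} \<subseteq> {x \<in> space M. \<exists>n. avg n f' x > l / 2}"
  proof safe
    fix x assume x: "x \<in> space M" "(SUP n. ennreal (avg n f x)) > ennreal l"
    then obtain n where "ennreal (avg n f x) > ennreal l" by (auto simp: less_SUP_iff)
    then have n: "avg n f x > l" using l by (simp add: ennreal_less_iff)
    have "avg n f x \<le> avg n (\<lambda>x. f' x + l / 2) x"
      by (intro avg_mono x) (auto simp: f'_def l less_imp_le f(2))
    also have "\<dots> = avg n f' x + avg n (\<lambda>x. l / 2) x" by (rule avg_add)
    \<comment> \<open>Only an inequality, since the average over an empty \<open>F n\<close> is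
      0.\<close>
    also have "avg n (\<lambda>x. l / 2) x \<le> l / 2" using l by (simp add: avg_def)
    finally show "\<exists>n. avg n f' x > l / 2" using n by (intro exI[of _ n]) simp
  qed
  then have "measure M {x \<in> space M. (SUP n. ennreal (avg n f x)) > ennreal l}
      \<le> measure M {x \<in> space M. \<exists>n. avg n f' x > l / 2}"
    by (intro finite_measure_mono) measurable
  also have "\<dots> \<le> 4 * K / (l / 2) * (LINT x|M. f' x)"
    using l f(2) by (intro maximal_inequality f') (auto simp: f'_def)
  finally have "l * measure M {x \<in> space M. (SUP n. ennreal (avg n f x)) > ennreal l} \<le> 8 * K * (LINT x|M. f' x)"
    using l by (simp add: field_simps)
  then have le: "ennreal (l * measure M {x \<in> space M. (SUP n. ennreal (avg n f x)) > ennreal l})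
      \<le> ennreal (8 * K * (LINT x|M. f' x))"
    by (rule ennreal_leI)
  then show "ennreal l * emeasure M {x \<in> space M. (SUP n. ennreal (avg n f x)) > ennreal l}
      \<le> ennreal (8 * K) * (\<integral>\<^sup>+x. ennreal (if f x > l / 2 then f x else 0) \<partial>M)"
  proof -
    have "f' x \<ge> 0" for x using f(2) by (simp add: f'_def)
    then show ?thesis
      unfolding f'_def[symmetric] emeasure_eq_measure using le l K_nonneg nn_integral_eq_integral[OF f']
      by (simp add: ennreal_mult)
  qed
qed (use f p K_nonneg borel_measurable_integrable[OF f(1)] in auto)

end

section \<open>Almost everywhere convergence\<close>

locale Z2_ergodic_folner_averages = Z2_averages +
  assumes F_nonempty: "\<And>n. n \<ge> 1 \<Longrightarrow> F n \<noteq> {}"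
    and F_folner: "\<And>p. (\<lambda>n. real (card (F n - (+) p ` F n)) / real (card (F n))) \<longlonglongrightarrow> 0"
    and ergodic: "\<And>A. A \<in> sets M \<Longrightarrow> (\<And>p. act p -` A \<inter> space M = A) \<Longrightarrow> measure M A = 0 \<or> measure M A = 1"
begin

text \<open>Acting by \<open>p\<close> replaces \<open>F n\<close> by its translate, and the two
  sums cancel except on the symmetric difference, where each term is at most \<open>B\<close>. The
  convergence holds at every point, not just almost everywhere.\<close>

lemma avg_act_diff_tendsto:
  assumes h: "\<And>x. x \<in> space M \<Longrightarrow> \<bar>h x\<bar> \<le> B" and x: "x \<in> space M"
  shows "(\<lambda>n. avg n (\<lambda>x. h (act p x)) x - avg n h x) \<longlonglongrightarrow> 0"
proof (rule Lim_null_comparison)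
  show "(\<lambda>n. 2 * B * (real (card (F n - (+) p ` F n)) / real (card (F n)))) \<longlonglongrightarrow> 0"
    using tendsto_mult_left[OF F_folner, of "2 * B" p] by simp
  have "norm (avg n (\<lambda>x. h (act p x)) x - avg n h x)
      \<le> 2 * B * (real (card (F n - (+) p ` F n)) / real (card (F n)))" for n
  proof -
    let ?G = "(+) p ` F n" and ?s = "\<lambda>q. h (act q x)"
    have bound: "\<bar>sum ?s A\<bar> \<le> B * card A" for A
    proof -
      have "\<bar>sum ?s A\<bar> \<le> (\<Sum>q\<in>A. B)"
        by (rule order_trans[OF sum_abs sum_mono]) (simp add: h act_space x)
      then show ?thesis by (simp add: mult.commute)
    qed
    have fin: "finite ?G" "finite (F n)" using F_finite by auto
    \<comment> \<open>The Folner condition controls one of the two set differences; equal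
      cardinalities carry it over to the other.\<close>
    have "card ?G = card (F n)" by (intro card_image) (auto simp: inj_on_def)
    moreover have "card (?G - F n) = card ?G - card (?G \<inter> F n)"
      "card (F n - ?G) = card (F n) - card (?G \<inter> F n)"
      using fin by (simp_all add: card_Diff_subset_Int Int_commute)
    ultimately have card: "card (?G - F n) = card (F n - ?G)" by simp
    have "(\<Sum>q\<in>F n. h (act p (act q x))) = sum ?s ?G"
      by (subst sum.reindex) (auto simp: inj_on_def act_add x)
    also have "\<dots> - sum ?s (F n) = sum ?s (?G - F n) - sum ?s (F n - ?G)"
      using sum.Int_Diff[OF fin(1), of ?s "F n"] sum.Int_Diff[OF fin(2), of ?s ?G]
      by (simp add: Int_commute)
    finally have "\<bar>(\<Sum>q\<in>F n. h (act p (act q x))) - sum ?s (F n)\<bar> \<le> 2 * B * card (F n - ?G)"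
      using bound[of "?G - F n"] bound[of "F n - ?G"] card by simp
    then have "\<bar>(\<Sum>q\<in>F n. h (act p (act q x))) - sum ?s (F n)\<bar> / card (F n)
        \<le> 2 * B * card (F n - ?G) / card (F n)"
      by (rule divide_right_mono) simp
    then show ?thesis
      by (simp add: avg_def diff_divide_distrib[symmetric] abs_divide)
  qed
  then show "\<forall>\<^sub>F n in sequentially. norm (avg n (\<lambda>x. h (act p x)) x - avg n h x)
      \<le> 2 * B * (real (card (F n - (+) p ` F n)) / real (card (F n)))"
    by (intro always_eventually allI)
qed

lemma AE_act:
  assumes "AE x in M. P x" shows "AE x in M. P (act p x)"
proof (rule AE_distrD[OF act_measurable])
  show "AE x in distr M M (act p). P x" unfolding act_distr by (rule assms)
qed

text \<open>Ergodicity speaks of strictly invariant sets, whereas \<open>h\<close> is invariant only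
  almost everywhere. Requiring positivity along the whole orbit makes \<open>A\<close> strictly
  invariant; it is measurable because the group is countable, and it equals the set where
  \<open>h\<close> is positive up to a null set. Full measure would contradict the vanishing
  integral.\<close>

lemma invariant_le_0:
  fixes h :: "'a \<Rightarrow> real"
  assumes h: "integrable M h" "(LINT x|M. h x) = 0"
    and inv: "\<And>p. AE x in M. h (act p x) = h x"
  shows "AE x in M. h x \<le> 0"
proof -
  note [measurable] = borel_measurable_integrable[OF h(1)]
  define A where "A = {x \<in> space M. \<forall>p. h (act p x) > 0}"
  have A [measurable]: "A \<in> sets M" unfolding A_def by measurable
  have AE_inv: "AE x in M. \<forall>p. h (act p x) = h x" using inv by (simp add: AE_all_countable)
  have "act q -` A \<inter> space M = A" for q
  proof -
    have "x \<in> act q -` A \<longleftrightarrow> x \<in> A" if x: "x \<in> space M" for x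
    proof -
      have "x \<in> act q -` A \<longleftrightarrow> (\<forall>p. h (act (p + q) x) > 0)"
        by (simp add: A_def act_space x act_add)
      also have "\<dots> \<longleftrightarrow> (\<forall>p. h (act p x) > 0)" by (metis diff_add_cancel)
      finally show ?thesis by (simp add: A_def x)
    qed
    moreover have "A \<subseteq> space M" by (auto simp: A_def)
    ultimately show ?thesis by blast
  qed
  then consider "measure M A = 0" | "measure M A = 1" using ergodic[OF A] by blast
  then show ?thesis
  proof cases
    case 1
    then have "AE x in M. x \<notin> A" using prob_eq_0[OF A] by simp
    with AE_inv AE_space show ?thesis
      by eventually_elim (auto simp: A_def not_less)
  next
    case 2
    then have "AE x in M. x \<in> A" using AE_in_set_eq_1[OF A] by simp
    with AE_inv have pos: "AE x in M. h x > 0" by eventually_elim (auto simp: A_def)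
    then have "AE x in M. 0 \<le> h x" by eventually_elim simp
    then have "AE x in M. h x = 0" using h integral_nonneg_eq_0_iff_AE[OF h(1)] by simp
    then have "AE x in M. \<not> h x > 0" by eventually_elim simp
    then show ?thesis using AE_contr[OF pos] by blast
  qed
qed

lemma invariant_eq_0:
  fixes h :: "'a \<Rightarrow> real"
  assumes h: "integrable M h" "(LINT x|M. h x) = 0"
    and inv: "\<And>p. AE x in M. h (act p x) = h x"
  shows "AE x in M. h x = 0"
proof -
  have "AE x in M. - h x \<le> 0"
    by (rule invariant_le_0) (use assms in auto)
  with invariant_le_0[OF assms] show ?thesis by eventually_elim simp
qed

text \<open>Replaces von Neumann's decomposition: in the class of bounded functions whose averages are
  asymptotic to those of \<open>g\<close>, an \<open>L\<^sup>2\<close>-minimizing sequence is Cauchy by the parallelogram law. Its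
  limit is invariant, because the class is stable under midpoints and under the action, and hence
  vanishes by ergodicity.\<close>

lemma bounded_asymptotically_small:
  fixes g :: "'a \<Rightarrow> real"
  assumes g: "g \<in> borel_measurable M" "\<And>x. x \<in> space M \<Longrightarrow> \<bar>g x\<bar> \<le> B" "(LINT x|M. g x) = 0"
    and d: "d > 0"
  obtains h where "integrable M h" "(LINT x|M. \<bar>h x\<bar>) \<le> d"
    "\<And>x. x \<in> space M \<Longrightarrow> (\<lambda>n. avg n g x - avg n h x) \<longlonglongrightarrow> 0"
proof -
  \<comment> \<open>The common bound \<open>B\<close> provides the dominating functions for all
    limits below.\<close>
  define G where "G = {h \<in> borel_measurable M. (\<forall>x\<in>space M. \<bar>h x\<bar> \<le> B) \<and> (LINT x|M. h x) = 0 \<and>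
    (\<forall>x\<in>space M. (\<lambda>n. avg n g x - avg n h x) \<longlonglongrightarrow> 0)}"
  have gG: "g \<in> G" using g by (simp add: G_def)
  have GD: "h \<in> borel_measurable M" "\<And>x. x \<in> space M \<Longrightarrow> \<bar>h x\<bar> \<le> B" "(LINT x|M. h x) = 0"
    "\<And>x. x \<in> space M \<Longrightarrow> (\<lambda>n. avg n g x - avg n h x) \<longlonglongrightarrow> 0" if "h \<in> G" for h
    using that by (auto simp: G_def)
  have B0: "B \<ge> 0" using g(2) not_empty by force
  have G_int: "integrable M h" if "h \<in> G" for h
    by (rule integrable_const_bound[of _ B]) (use GD[OF that] in auto)
  have G_int_mult: "integrable M (\<lambda>x. h x * k x)" if "h \<in> G" "k \<in> G" for h k
  proof (rule integrable_const_bound[of _ "B * B"])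
    show "AE x in M. norm (h x * k x) \<le> B * B"
    proof (rule AE_I2)
      fix x assume x: "x \<in> space M"
      show "norm (h x * k x) \<le> B * B"
        unfolding real_norm_def abs_mult
        by (intro mult_mono GD(2)[OF that(1) x] GD(2)[OF that(2) x] B0) simp
    qed
    show "(\<lambda>x. h x * k x) \<in> borel_measurable M"
      using GD(1)[OF that(1)] GD(1)[OF that(2)] by measurable
  qed
  have G_act: "(\<lambda>x. h (act p x)) \<in> G" if h: "h \<in> G" for h p
  proof -
    have "(\<lambda>n. avg n g x - avg n (\<lambda>x. h (act p x)) x) \<longlonglongrightarrow> 0" if x: "x \<in> space M" for x
    proof -
      have "(\<lambda>n. avg n (\<lambda>x. h (act p x)) x - avg n h x) \<longlonglongrightarrow> 0"
        using GD(2)[OF h] x by (rule avg_act_diff_tendsto)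
      from tendsto_diff[OF GD(4)[OF h x] this] show ?thesis by simp
    qed
    moreover have "(\<lambda>x. h (act p x)) \<in> borel_measurable M"
      using GD(1)[OF h] by measurable
    ultimately show ?thesis
      using GD(2,3)[OF h] integral_act[OF GD(1)[OF h]] by (simp add: G_def act_space)
  qed
  have G_mid: "(\<lambda>x. (h x + k x) / 2) \<in> G" if h: "h \<in> G" and k: "k \<in> G" for h k
  proof -
    have avg_mid: "avg n (\<lambda>x. (h x + k x) / 2) x = (avg n h x + avg n k x) / 2" for n x
      using avg_cmult[of n "1/2" "\<lambda>x. h x + k x" x] avg_add[of n h k x] by simp
    have "(\<lambda>n. avg n g x - avg n (\<lambda>x. (h x + k x) / 2) x) \<longlonglongrightarrow> 0" if x: "x \<in> space M" for x
    proof -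
      have "(\<lambda>n. ((avg n g x - avg n h x) + (avg n g x - avg n k x)) / 2) \<longlonglongrightarrow> (0 + 0) / 2"
        by (intro tendsto_divide tendsto_add GD(4)[OF h x] GD(4)[OF k x] tendsto_const) simp
      also have "(\<lambda>n. ((avg n g x - avg n h x) + (avg n g x - avg n k x)) / 2)
          = (\<lambda>n. avg n g x - avg n (\<lambda>x. (h x + k x) / 2) x)"
        by (simp add: avg_mid field_simps)
      finally show ?thesis by simp
    qed
    moreover have "\<bar>(h x + k x) / 2\<bar> \<le> B" if x: "x \<in> space M" for x
    proof -
      have "\<bar>h x + k x\<bar> \<le> 2 * B"
        using abs_triangle_ineq[of "h x" "k x"] GD(2)[OF h x] GD(2)[OF k x] by simp
      then show ?thesis by (simp add: abs_divide)
    qed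
    moreover have "(LINT x|M. (h x + k x) / 2) = 0"
      using GD(3)[OF h] GD(3)[OF k] G_int[OF h] G_int[OF k] by simp
    moreover have "(\<lambda>x. (h x + k x) / 2) \<in> borel_measurable M"
      using GD(1)[OF h] GD(1)[OF k] by measurable
    ultimately show ?thesis by (simp add: G_def)
  qed
  define E where "E h = (LINT x|M. h x * h x)" for h :: "'a \<Rightarrow> real"
  define c where "c = Inf (E ` G)"
  have bdd: "bdd_below (E ` G)" by (rule bdd_belowI[of _ 0]) (auto simp: E_def)
  have c_le: "c \<le> E h" if "h \<in> G" for h
    unfolding c_def using that by (intro cInf_lower bdd) auto
  \<comment> \<open>The midpoint lies in \<open>G\<close> and so has energy at least
    \<open>c\<close>: two members of nearly minimal energy are close in
    \<open>L\<^sup>2\<close>.\<close>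
  have parallelogram: "(LINT x|M. (h x - k x) * (h x - k x)) \<le> 2 * E h + 2 * E k - 4 * c"
    if h: "h \<in> G" and k: "k \<in> G" for h k
  proof -
    note int = G_int_mult[OF h h] G_int_mult[OF k k] G_int_mult[OF h k]
      G_int_mult[OF G_mid[OF h k] G_mid[OF h k]]
    have "(LINT x|M. (h x - k x) * (h x - k x))
        = (LINT x|M. 2 * (h x * h x) + 2 * (k x * k x) - 4 * ((h x + k x) / 2 * ((h x + k x) / 2)))"
      by (intro Bochner_Integration.integral_cong) (auto simp: field_simps)
    also have "\<dots> = 2 * E h + 2 * E k - 4 * E (\<lambda>x. (h x + k x) / 2)"
      unfolding E_def using int
      by (subst Bochner_Integration.integral_diff Bochner_Integration.integral_add;
          (intro Bochner_Integration.integrable_add integrable_mult_right)?; simp)+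
    finally show ?thesis using c_le[OF G_mid[OF h k]] by simp
  qed
  \<comment> \<open>A substitute for Cauchy-Schwarz on a probability space: if the integral of the
    square is at most \<open>e\<^sup>2\<close>, that of the absolute value is at most
    \<open>e\<close>.\<close>
  have abs_bound: "(LINT x|M. \<bar>z x\<bar>) \<le> e / 2 + (LINT x|M. z x * z x) / (2 * e)"
    if "integrable M z" "integrable M (\<lambda>x. z x * z x)" "e > 0" for z :: "'a \<Rightarrow> real" and e :: real
  proof -
    have "(LINT x|M. \<bar>z x\<bar>) \<le> (LINT x|M. e / 2 + z x * z x / (2 * e))"
    proof (rule integral_mono)
      fix x
      have "0 \<le> (\<bar>z x\<bar> - e)\<^sup>2" by simp
      then have "2 * e * \<bar>z x\<bar> \<le> e * e + z x * z x" by (simp add: power2_eq_square algebra_simps)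
      then show "\<bar>z x\<bar> \<le> e / 2 + z x * z x / (2 * e)" using that(3) by (simp add: field_simps)
    qed (use that in auto)
    also have "\<dots> = e / 2 + (LINT x|M. z x * z x) / (2 * e)"
      using that by (subst Bochner_Integration.integral_add) (auto simp: prob_space)
    finally show ?thesis .
  qed
  have "\<forall>n. \<exists>h. h \<in> G \<and> E h < c + 1 / real (Suc n)"
  proof
    fix n
    have "Inf (E ` G) < c + 1 / real (Suc n)" unfolding c_def[symmetric] by simp
    then show "\<exists>h. h \<in> G \<and> E h < c + 1 / real (Suc n)"
      using gG bdd by (subst (asm) cInf_less_iff) auto
  qed
  then obtain h where hG: "\<And>n. h n \<in> G" and hE: "\<And>n. E (h n) < c + 1 / real (Suc n)" by metis
  have int_diff: "integrable M (\<lambda>x. k x - l x)" "integrable M (\<lambda>x. (k x - l x) * (k x - l x))"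
    if "k \<in> G" "l \<in> G" for k l
  proof -
    show "integrable M (\<lambda>x. k x - l x)" using G_int that by simp
    have "integrable M (\<lambda>x. k x * k x + l x * l x - k x * l x - k x * l x)"
      using G_int_mult that by (intro Bochner_Integration.integrable_diff Bochner_Integration.integrable_add) auto
    then show "integrable M (\<lambda>x. (k x - l x) * (k x - l x))"
      by (simp add: algebra_simps)
  qed
  have "\<exists>N. \<forall>i\<ge>N. \<forall>j\<ge>N. (LINT x|M. norm (h i x - h j x)) < e" if e: "e > 0" for e
  proof -
    \<comment> \<open>The energies of \<open>h i\<close> and \<open>h j\<close> exceed
      \<open>c\<close> by less than \<open>1 / N\<close>, so the parallelogram bound is below
      \<open>4 / N\<close>, hence below \<open>e\<^sup>2\<close>.\<close>
    obtain N where N: "4 / e\<^sup>2 < real N" using reals_Archimedean2 by blast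
    have "(LINT x|M. norm (h i x - h j x)) < e" if ij: "i \<ge> N" "j \<ge> N" for i j
    proof -
      have N0: "real N > 0" using N e by (smt (verit) divide_pos_pos zero_less_power)
      have "1 / real (Suc i) \<le> 1 / N" "1 / real (Suc j) \<le> 1 / N"
        using ij N0 by (auto simp: frac_le)
      then have "(LINT x|M. (h i x - h j x) * (h i x - h j x)) < 4 * (1 / N)"
        using parallelogram[OF hG[of i] hG[of j]] hE[of i] hE[of j] by linarith
      also have "\<dots> < e\<^sup>2" using N N0 e by (simp add: field_simps)
      finally have "(LINT x|M. (h i x - h j x) * (h i x - h j x)) / (2 * e) < e\<^sup>2 / (2 * e)"
        using e by (intro divide_strict_right_mono) auto
      also have "e\<^sup>2 / (2 * e) = e / 2" using e by (simp add: power2_eq_square)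
      finally show ?thesis
        using abs_bound[OF int_diff[OF hG hG] e, of i j] by simp
    qed
    then show ?thesis by blast
  qed
  \<comment> \<open>\<open>L\<^sup>1\<close> closeness is turned into almost everywhere convergence
    along a subsequence, which gives a concrete limit function.\<close>
  then obtain r where r: "strict_mono r" "AE x in M. Cauchy (\<lambda>i. h (r i) x)"
    by (rule cauchy_L1_AE_cauchy_subseq[of M h, rotated]) (auto intro: G_int hG)
  define k where "k n = h (r n)" for n
  have kG: "k n \<in> G" for n by (simp add: k_def hG)
  note [measurable] = GD(1)[OF kG]
  define hs where "hs x = lim (\<lambda>n. k n x)" for x
  have hs [measurable]: "hs \<in> borel_measurable M" unfolding hs_def by measurable
  have lim: "AE x in M. (\<lambda>n. k n x) \<longlonglongrightarrow> hs x"
    using r(2) by eventually_elim (simp add: k_def hs_def Cauchy_convergent_iff convergent_LIMSEQ_iff)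
  have Ek: "(\<lambda>n. E (k n)) \<longlonglongrightarrow> c"
  proof (rule tendsto_sandwich[where f = "\<lambda>_. c" and h = "\<lambda>n. c + 1 / real (Suc n)"])
    show "(\<lambda>n. c + 1 / real (Suc n)) \<longlonglongrightarrow> c"
      using tendsto_add[OF tendsto_const LIMSEQ_inverse_real_of_nat, of c] by (simp add: inverse_eq_divide)
    have "1 / real (Suc (r n)) \<le> 1 / real (Suc n)" for n
      using seq_suble[OF r(1), of n] by (simp add: frac_le)
    then have "E (k n) \<le> c + 1 / real (Suc n)" for n
      using hE[of "r n"] by (smt (verit) k_def)
    then show "\<forall>\<^sub>F n in sequentially. E (k n) \<le> c + 1 / real (Suc n)" by simp
    show "(\<lambda>n. c) \<longlonglongrightarrow> c" by (rule tendsto_const)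
    show "\<forall>\<^sub>F n in sequentially. c \<le> E (k n)" using c_le kG by simp
  qed
  have bound_AE: "AE x in M. \<bar>k n x\<bar> \<le> B" for n using GD(2)[OF kG] by (intro AE_I2)
  have "AE x in M. \<bar>hs x\<bar> \<le> B"
    using lim AE_space
  proof eventually_elim
    case (elim x)
    then show ?case
      using GD(2)[OF kG] by (intro LIMSEQ_le_const2[OF tendsto_rabs]) auto
  qed
  then have hs_int: "integrable M hs" by (intro integrable_const_bound[of _ B]) auto
  have "(\<lambda>n. LINT x|M. k n x) \<longlonglongrightarrow> (LINT x|M. hs x)"
    using lim bound_AE by (intro integral_dominated_convergence[where w = "\<lambda>_. B"]) auto
  then have hs0: "(LINT x|M. hs x) = 0"
    using GD(3)[OF kG] by (simp add: LIMSEQ_const_iff)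
  have "(\<lambda>n. E (k n)) \<longlonglongrightarrow> (LINT x|M. hs x * hs x)"
    unfolding E_def
  proof (rule integral_dominated_convergence[where w = "\<lambda>_. B * B"])
    show "AE x in M. (\<lambda>n. k n x * k n x) \<longlonglongrightarrow> hs x * hs x"
      using lim by eventually_elim (intro tendsto_mult)
    show "AE x in M. norm (k n x * k n x) \<le> B * B" for n
      using bound_AE[of n] unfolding real_norm_def abs_mult
      by eventually_elim (use B0 in \<open>intro mult_mono, auto\<close>)
  qed auto
  \<comment> \<open>The limit attains the infimum, so showing that it vanishes will give
    \<open>c = 0\<close>.\<close>
  then have Ehs: "(LINT x|M. hs x * hs x) = c"
    using Ek LIMSEQ_unique by blast
  have "AE x in M. hs (act p x) = hs x" for p
  proof -
    \<comment> \<open>Both \<open>k n\<close> and its translate lie in \<open>G\<close> with the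
      same energy, so the parallelogram bound forces their difference to 0 in
      \<open>L\<^sup>2\<close>; its limit is \<open>zs\<close>.\<close>
    define z where "z n x = k n x - k n (act p x)" for n x
    define zs where "zs x = hs x - hs (act p x)" for x
    have [measurable]: "z n \<in> borel_measurable M" "zs \<in> borel_measurable M" for n
      unfolding z_def zs_def by measurable
    have zlim: "AE x in M. (\<lambda>n. z n x * z n x) \<longlonglongrightarrow> zs x * zs x"
      using lim AE_act[OF lim, of p] unfolding z_def zs_def
      by eventually_elim (intro tendsto_mult tendsto_diff)
    have zbound: "AE x in M. norm (z n x * z n x) \<le> 2 * B * (2 * B)" for n
    proof (rule AE_I2)
      fix x assume x: "x \<in> space M"
      have "\<bar>z n x\<bar> \<le> 2 * B"
        using GD(2)[OF kG[of n] x] GD(2)[OF kG[of n] act_space[OF x, of p]] unfolding z_def by linarith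
      then show "norm (z n x * z n x) \<le> 2 * B * (2 * B)"
        unfolding real_norm_def abs_mult by (intro mult_mono) (use B0 in auto)
    qed
    have "(\<lambda>n. LINT x|M. z n x * z n x) \<longlonglongrightarrow> (LINT x|M. zs x * zs x)"
      by (rule integral_dominated_convergence[OF _ _ _ zlim zbound]) auto
    moreover have "(\<lambda>n. LINT x|M. z n x * z n x) \<longlonglongrightarrow> 0"
    proof (rule tendsto_sandwich[where f = "\<lambda>_. 0" and h = "\<lambda>n. 4 * E (k n) - 4 * c"])
      show "(\<lambda>n. 4 * E (k n) - 4 * c) \<longlonglongrightarrow> 0"
        using tendsto_diff[OF tendsto_mult_left[OF Ek, of 4] tendsto_const[of "4 * c"]] by simp
      have "E (\<lambda>x. k n (act p x)) = E (k n)" for n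
        unfolding E_def by (rule integral_act) measurable
      then have "(LINT x|M. z n x * z n x) \<le> 4 * E (k n) - 4 * c" for n
        using parallelogram[OF kG[of n] G_act[OF kG[of n], of p]] by (simp add: z_def)
      then show "\<forall>\<^sub>F n in sequentially. (LINT x|M. z n x * z n x) \<le> 4 * E (k n) - 4 * c" by simp
    qed auto
    ultimately have "(LINT x|M. zs x * zs x) = 0" using LIMSEQ_unique by blast
    moreover have "integrable M (\<lambda>x. zs x * zs x)"
      by (rule integrable_dominated_convergence[OF _ _ _ zlim zbound]) auto
    ultimately have "AE x in M. zs x * zs x = 0"
      using integral_nonneg_eq_0_iff_AE[of M "\<lambda>x. zs x * zs x"] by simp
    then show ?thesis by eventually_elim (simp add: zs_def)
  qed
  then have "AE x in M. hs x = 0" using invariant_eq_0[OF hs_int hs0] by blast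
  then have "AE x in M. hs x * hs x = 0" by eventually_elim simp
  then have "(LINT x|M. hs x * hs x) = 0"
    by (rule integral_eq_zero_AE)
  then have c0: "c = 0" using Ehs by simp
  \<comment> \<open>Energy at most \<open>d\<^sup>2\<close> with \<open>e = d\<close> in
    \<open>abs_bound\<close> gives \<open>d / 2 + d / 2\<close>.\<close>
  obtain n where "inverse (real (Suc n)) < d\<^sup>2" using reals_Archimedean[of "d\<^sup>2"] d by auto
  then have "E (h n) \<le> d\<^sup>2" using hE[of n] c0 by (simp add: inverse_eq_divide)
  then have "E (h n) / (2 * d) \<le> d\<^sup>2 / (2 * d)" using d by (intro divide_right_mono) auto
  also have "d\<^sup>2 / (2 * d) = d / 2" using d by (simp add: power2_eq_square)
  finally have "(LINT x|M. \<bar>h n x\<bar>) \<le> d"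
    using abs_bound[OF G_int[OF hG] G_int_mult[OF hG hG] d, of n] by (simp add: E_def)
  then show thesis using that[OF G_int[OF hG]] GD(4)[OF hG] by blast
qed

text \<open>Truncate \<open>f\<close>, subtract the mean of the truncation, and apply the bounded
  case to the result \<open>g\<close>; the error \<open>f - g\<close> is carried along inside the
  new function. The budget is \<open>d / 4\<close> for truncation, \<open>d / 4\<close> for the mean
  and \<open>d / 2\<close> for the bounded case.\<close>

lemma integrable_asymptotically_small:
  fixes f :: "'a \<Rightarrow> real"
  assumes f: "integrable M f" "(LINT x|M. f x) = 0" and d: "d > 0"
  obtains h where "integrable M h" "(LINT x|M. \<bar>h x\<bar>) \<le> d"
    "\<And>x. x \<in> space M \<Longrightarrow> (\<lambda>n. avg n f x - avg n h x) \<longlonglongrightarrow> 0"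
proof -
  note [measurable] = borel_measurable_integrable[OF f(1)]
  define tr where "tr m x = max (- real m) (min (real m) (f x))" for m :: nat and x
  have [measurable]: "tr m \<in> borel_measurable M" for m unfolding tr_def by measurable
  have tr_abs: "\<bar>f x - tr m x\<bar> \<le> \<bar>f x\<bar>" for m x by (auto simp: tr_def max_def min_def)
  have "(\<lambda>m. LINT x|M. \<bar>f x - tr m x\<bar>) \<longlonglongrightarrow> (LINT x|M. 0)"
  proof (rule integral_dominated_convergence[where w = "\<lambda>x. \<bar>f x\<bar>"])
    have "(\<lambda>m. \<bar>f x - tr m x\<bar>) \<longlonglongrightarrow> 0" for x
    proof (rule tendsto_eventually)
      obtain N where "\<bar>f x\<bar> \<le> real N" using real_arch_simple by blast
      then have "\<bar>f x - tr m x\<bar> = 0" if "m \<ge> N" for m using that by (auto simp: tr_def max_def min_def)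
      then show "\<forall>\<^sub>F m in sequentially. \<bar>f x - tr m x\<bar> = 0"
        unfolding eventually_sequentially by blast
    qed
    then show "AE x in M. (\<lambda>m. \<bar>f x - tr m x\<bar>) \<longlonglongrightarrow> 0" by simp
  qed (use f tr_abs in auto)
  then have "\<forall>\<^sub>F m in sequentially. (LINT x|M. \<bar>f x - tr m x\<bar>) < d / 4"
    using d by (intro order_tendstoD(2)[where y = 0]) auto
  then obtain m where m: "(LINT x|M. \<bar>f x - tr m x\<bar>) < d / 4"
    by (auto simp: eventually_sequentially)
  have tr_bound: "\<bar>tr m x\<bar> \<le> real m" for x by (auto simp: tr_def max_def min_def)
  have tr_int: "integrable M (tr m)"
    by (rule integrable_const_bound[of _ "real m"]) (use tr_bound in auto)
  define e where "e = (LINT x|M. tr m x)"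
  \<comment> \<open>As \<open>f\<close> has integral 0, the mean of the truncation is no larger than
    the truncation error.\<close>
  have e: "\<bar>e\<bar> \<le> d / 4"
  proof -
    have "\<bar>e\<bar> = \<bar>LINT x|M. f x - tr m x\<bar>" using f tr_int by (simp add: e_def)
    also have "\<dots> \<le> (LINT x|M. \<bar>f x - tr m x\<bar>)" by (rule integral_abs_bound)
    finally show ?thesis using m by simp
  qed
  define g where "g x = tr m x - e" for x
  have "integrable M (\<lambda>x. tr m x - e)" using tr_int by simp
  then have g: "integrable M g" "(LINT x|M. g x) = 0"
    using tr_int by (auto simp: g_def[abs_def] e_def prob_space)
  obtain h where h: "integrable M h" "(LINT x|M. \<bar>h x\<bar>) \<le> d / 2"
    "\<And>x. x \<in> space M \<Longrightarrow> (\<lambda>n. avg n g x - avg n h x) \<longlonglongrightarrow> 0"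
  proof (rule bounded_asymptotically_small[of g "real m + \<bar>e\<bar>" "d / 2"])
    show "\<bar>g x\<bar> \<le> real m + \<bar>e\<bar>" for x using tr_bound[of x] unfolding g_def by linarith
  qed (use g d in auto)
  let ?h = "\<lambda>x. (f x - g x) + h x"
  have "integrable M ?h" using f g h by simp
  moreover have "(LINT x|M. \<bar>?h x\<bar>) \<le> d"
  proof -
    have "(LINT x|M. \<bar>?h x\<bar>) \<le> (LINT x|M. (\<bar>f x - tr m x\<bar> + \<bar>e\<bar>) + \<bar>h x\<bar>)"
      using f h g tr_int by (intro integral_mono) (auto simp: g_def)
    also have "\<dots> = (LINT x|M. \<bar>f x - tr m x\<bar>) + \<bar>e\<bar> + (LINT x|M. \<bar>h x\<bar>)"
      using f h tr_int by (simp add: prob_space)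
    finally show ?thesis using m e h(2) by linarith
  qed
  moreover have "(\<lambda>n. avg n f x - avg n ?h x) \<longlonglongrightarrow> 0" if "x \<in> space M" for x
    using h(3)[OF that] by (simp add: avg_add avg_diff)
  ultimately show thesis by (rule that)
qed

text \<open>At a point of \<open>S j\<close> the averages of \<open>f\<close> exceed
  \<open>1 / real (Suc j)\<close> infinitely often, so those of any asymptotically equal
  \<open>h\<close> must exceed half of it. Since \<open>h\<close> can have arbitrarily small
  \<open>L\<^sup>1\<close> norm, the maximal inequality makes \<open>S j\<close> a null set.\<close>

lemma avg_tendsto_0:
  fixes f :: "'a \<Rightarrow> real"
  assumes f: "integrable M f" "(LINT x|M. f x) = 0"
  shows "AE x in M. (\<lambda>n. avg n f x) \<longlonglongrightarrow> 0"
proof -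
  note [measurable] = borel_measurable_integrable[OF f(1)]
  define S where "S j = {x \<in> space M. \<not> (\<exists>N. \<forall>n\<ge>N. \<bar>avg n f x\<bar> \<le> 1 / real (Suc j))}" for j :: nat
  have S [measurable]: "S j \<in> sets M" for j unfolding S_def by measurable
  have "AE x in M. x \<notin> S j" for j
  proof -
    define l where "l = 1 / real (Suc j)"
    have l: "l > 0" by (simp add: l_def)
    have bound: "measure M (S j) \<le> 4 * K / (l / 2) * d" if d: "d > 0" for d
    proof -
      obtain h where h: "integrable M h" "(LINT x|M. \<bar>h x\<bar>) \<le> d"
        "\<And>x. x \<in> space M \<Longrightarrow> (\<lambda>n. avg n f x - avg n h x) \<longlonglongrightarrow> 0"
        by (rule integrable_asymptotically_small[OF f d]) auto
      note [measurable] = borel_measurable_integrable[OF h(1)]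
      have "S j \<subseteq> {x \<in> space M. \<exists>n. avg n (\<lambda>x. \<bar>h x\<bar>) x > l / 2}"
      proof (rule subsetI, rule ccontr)
        fix x assume x: "x \<in> S j" and "x \<notin> {x \<in> space M. \<exists>n. avg n (\<lambda>x. \<bar>h x\<bar>) x > l / 2}"
        moreover from x have xM: "x \<in> space M" by (simp add: S_def)
        ultimately have le: "avg n (\<lambda>x. \<bar>h x\<bar>) x \<le> l / 2" for n by (simp add: not_less)
        have "\<exists>N. \<forall>n\<ge>N. norm (avg n f x - avg n h x - 0) < l / 2"
          by (rule LIMSEQ_D[OF h(3)[OF xM]]) (use l in simp)
        then obtain N where N: "\<And>n. n \<ge> N \<Longrightarrow> \<bar>avg n f x - avg n h x\<bar> < l / 2" by auto
        have "\<bar>avg n f x\<bar> \<le> l" if "n \<ge> N" for n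
          using N[OF that] le[of n] abs_avg_le[of n h x] by linarith
        then show False using x unfolding S_def l_def by blast
      qed
      then have "measure M (S j) \<le> measure M {x \<in> space M. \<exists>n. avg n (\<lambda>x. \<bar>h x\<bar>) x > l / 2}"
        by (intro finite_measure_mono) measurable
      also have "\<dots> \<le> 4 * K / (l / 2) * (LINT x|M. \<bar>h x\<bar>)"
        using l h(1) by (intro maximal_inequality) auto
      also have "\<dots> \<le> 4 * K / (l / 2) * d"
        using h(2) l K_nonneg by (intro mult_left_mono) auto
      finally show ?thesis .
    qed
    have "measure M (S j) \<le> 0 + e" if e: "e > 0" for e
    proof -
      \<comment> \<open>Dividing by \<open>D + 1\<close> keeps the chosen norm bound positive and
        finite when \<open>K = 0\<close>.\<close>
      define D where "D = 4 * K / (l / 2)"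
      have D: "D \<ge> 0" using K_nonneg l by (simp add: D_def)
      have "measure M (S j) \<le> D * (e / (D + 1))" unfolding D_def
        using D e by (intro bound) (auto simp: D_def)
      also have "\<dots> \<le> e" using D e by (simp add: field_simps)
      finally show ?thesis by simp
    qed
    then have "measure M (S j) \<le> 0" by (rule field_le_epsilon)
    then show ?thesis using prob_eq_0[OF S] by (simp add: measure_le_0_iff)
  qed
  then have "AE x in M. \<forall>j. x \<notin> S j" by (simp add: AE_all_countable)
  with AE_space show ?thesis
  proof eventually_elim
    case (elim x)
    show ?case
    proof (rule LIMSEQ_I)
      fix e :: real assume "e > 0"
      then obtain j where j: "inverse (real (Suc j)) < e" using reals_Archimedean by blast
      obtain N where "\<And>n. n \<ge> N \<Longrightarrow> \<bar>avg n f x\<bar> \<le> 1 / real (Suc j)"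
        using elim by (auto simp: S_def)
      then show "\<exists>N. \<forall>n\<ge>N. norm (avg n f x - 0) < e"
        using j by (intro exI[of _ N]) (force simp: inverse_eq_divide)
    qed
  qed
qed

lemma avg_tendsto_integral:
  fixes f :: "'a \<Rightarrow> real"
  assumes f: "integrable M f"
  shows "AE x in M. (\<lambda>n. avg n f x) \<longlonglongrightarrow> (LINT x|M. f x)"
proof -
  define c where "c = (LINT x|M. f x)"
  have "AE x in M. (\<lambda>n. avg n (\<lambda>x. f x - c) x) \<longlonglongrightarrow> 0"
    using f by (intro avg_tendsto_0) (auto simp: c_def prob_space)
  then show ?thesis
    unfolding c_def[symmetric]
  proof eventually_elim
    case (elim x)
    \<comment> \<open>Constants average to themselves only over nonempty sets, hence from
      \<open>n = 1\<close> on.\<close>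
    have "\<forall>\<^sub>F n in sequentially. avg n (\<lambda>x. f x - c) x = avg n f x - c"
      using eventually_ge_at_top[of 1]
      by eventually_elim (simp add: avg_diff avg_const F_nonempty)
    then have "(\<lambda>n. avg n f x - c) \<longlonglongrightarrow> 0"
      using elim by (rule Lim_transform_eventually[rotated])
    then show ?case by (rule LIM_zero_cancel)
  qed
qed

end

section \<open>The action generated by two commuting transformations\<close>

context
  fixes M :: "'a measure" and S :: "'a \<Rightarrow> 'a"
  assumes S: "invertible_measure_preserving M S"
begin

lemma
  shows imp_measurable: "S \<in> measurable M M"
    and imp_inv_measurable: "inv_into (space M) S \<in> measurable M M"
    and imp_distr: "distr M M S = M"
    and imp_inv_left: "x \<in> space M \<Longrightarrow> inv_into (space M) S (S x) = x"
    and imp_inv_right: "x \<in> space M \<Longrightarrow> S (inv_into (space M) S x) = x"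
  using S bij_betw_inv_into_left[of S "space M" "space M" x]
    bij_betw_inv_into_right[of S "space M" "space M" x]
  unfolding invertible_measure_preserving_def by auto

lemma imp_inv_distr: "distr M M (inv_into (space M) S) = M"
proof -
  have "distr M M (inv_into (space M) S) = distr (distr M M S) M (inv_into (space M) S)"
    by (simp add: imp_distr)
  also have "\<dots> = distr M M (inv_into (space M) S \<circ> S)"
    by (rule distr_distr[OF imp_inv_measurable imp_measurable])
  also have "\<dots> = distr M M (\<lambda>x. x)"
    by (intro distr_cong) (auto simp: imp_inv_left)
  finally show ?thesis by simp
qed

lemma funpow_measure_preserving:
  assumes f: "f \<in> measurable M M" "distr M M f = M"
  shows "f ^^ n \<in> measurable M M \<and> distr M M (f ^^ n) = M"
proof (induction n)
  case 0
  then show ?case by (simp add: id_def)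
next
  case (Suc n)
  then have "distr (distr M M (f ^^ n)) M f = distr M M (f \<circ> f ^^ n)"
    by (intro distr_distr f) auto
  then have "distr M M (f \<circ> f ^^ n) = M" using Suc f by simp
  moreover have "f \<circ> f ^^ n \<in> measurable M M" using Suc f by (blast intro: measurable_comp)
  ultimately show ?case by (simp only: funpow.simps)
qed

lemma int_iterate_measurable: "int_iterate M S i \<in> measurable M M"
  and int_iterate_distr: "distr M M (int_iterate M S i) = M"
  using funpow_measure_preserving[OF imp_measurable imp_distr]
    funpow_measure_preserving[OF imp_inv_measurable imp_inv_distr]
  by (auto simp: int_iterate_def)

lemma int_iterate_space: "x \<in> space M \<Longrightarrow> int_iterate M S i x \<in> space M"
  using measurable_space[OF int_iterate_measurable] .

lemma int_iterate_0 [simp]: "int_iterate M S 0 x = x"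
  by (simp add: int_iterate_def)

text \<open>Absorbs the case split on signs in \<open>int_iterate\<close>, so that later proofs can
  run by induction over the integers in both directions.\<close>

lemma int_iterate_succ:
  assumes x: "x \<in> space M"
  shows "int_iterate M S (i + 1) x = S (int_iterate M S i x)"
proof (cases "i \<ge> 0")
  case True
  then show ?thesis by (simp add: int_iterate_def nat_add_distrib)
next
  case False
  define n where "n = nat (- i - 1)"
  have i: "i = - int (Suc n)" using False by (simp add: n_def)
  let ?S' = "inv_into (space M) S"
  have "int_iterate M S (- int k) = ?S' ^^ k" for k
    by (cases "k = 0") (auto simp: int_iterate_def)
  from this[of n] this[of "Suc n"]
  have "int_iterate M S (i + 1) x = (?S' ^^ n) x" "int_iterate M S i x = ?S' ((?S' ^^ n) x)"
    by (simp_all add: i)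
  moreover have "(?S' ^^ n) x \<in> space M"
    using measurable_space[OF conjunct1[OF funpow_measure_preserving[OF imp_inv_measurable imp_inv_distr]] x] .
  ultimately show ?thesis by (simp add: imp_inv_right)
qed

lemma int_iterate_pred:
  assumes x: "x \<in> space M"
  shows "int_iterate M S (i - 1) x = inv_into (space M) S (int_iterate M S i x)"
  using int_iterate_succ[OF x, of "i - 1"] imp_inv_left[OF int_iterate_space[OF x, of "i - 1"]] by simp

lemma int_iterate_add:
  assumes x: "x \<in> space M"
  shows "int_iterate M S (i + j) x = int_iterate M S i (int_iterate M S j x)"
proof (induction i rule: int_induct[of _ 0])
  case (step1 i)
  have "int_iterate M S (i + 1 + j) x = S (int_iterate M S (i + j) x)"
    using int_iterate_succ[OF x, of "i + j"] by (simp add: ac_simps)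
  then show ?case using step1 by (simp add: int_iterate_succ int_iterate_space x)
next
  case (step2 i)
  have "int_iterate M S (i - 1 + j) x = inv_into (space M) S (int_iterate M S (i + j) x)"
    using int_iterate_pred[OF x, of "i + j"] by (simp add: algebra_simps)
  then show ?case using step2 by (simp add: int_iterate_pred int_iterate_space x)
qed simp

text \<open>Stated for an arbitrary commuting self-map so that it can be used twice: first with
  \<open>T\<close>, then with a power of \<open>S\<close>, to make all powers commute.\<close>

lemma int_iterate_commute:
  assumes g: "\<And>x. x \<in> space M \<Longrightarrow> g x \<in> space M" "\<And>x. x \<in> space M \<Longrightarrow> S (g x) = g (S x)"
    and x: "x \<in> space M"
  shows "int_iterate M S i (g x) = g (int_iterate M S i x)"
proof (induction i rule: int_induct[of _ 0])
  case (step1 i)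
  then show ?case by (simp add: int_iterate_succ int_iterate_space g x)
next
  case (step2 i)
  let ?y = "int_iterate M S (i - 1) x"
  have y: "?y \<in> space M" by (rule int_iterate_space[OF x])
  have "S ?y = int_iterate M S i x" using int_iterate_succ[OF x, of "i - 1"] by simp
  then have "int_iterate M S i (g x) = S (g ?y)" using step2 g(2)[OF y] by simp
  have "int_iterate M S (i - 1) (g x) = inv_into (space M) S (S (g ?y))"
    using int_iterate_pred[OF g(1)[OF x], of i] \<open>int_iterate M S i (g x) = S (g ?y)\<close> by simp
  then show ?case using imp_inv_left[OF g(1)[OF y]] by simp
qed simp

end

section \<open>The lattice action and its product sets\<close>

definition Z2_act :: "'a measure \<Rightarrow> ('a \<Rightarrow> 'a) \<Rightarrow> ('a \<Rightarrow> 'a) \<Rightarrow> int \<times> int \<Rightarrow> 'a \<Rightarrow> 'a" where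
  "Z2_act M S T p = int_iterate M S (fst p) \<circ> int_iterate M T (snd p)"

locale commuting_block_averages = prob_space M + sb: block_enumeration a u s C + tb: block_enumeration b v t C
  for M :: "'a measure" and S T :: "'a \<Rightarrow> 'a"
    and a b :: "nat \<Rightarrow> nat" and u v s t :: "nat \<Rightarrow> int" and C :: real +
  assumes S: "invertible_measure_preserving M S" and T: "invertible_measure_preserving M T"
    and commute: "\<And>x. x \<in> space M \<Longrightarrow> S (T x) = T (S x)"
begin

abbreviation act :: "int \<times> int \<Rightarrow> 'a \<Rightarrow> 'a" where "act \<equiv> Z2_act M S T"

definition F :: "nat \<Rightarrow> (int \<times> int) set" where
  "F n = s ` {1..n} \<times> t ` {1..n}"

lemma card_F: "card (F n) = n * n"
  by (simp only: F_def card_cartesian_product sb.card_initial tb.card_initial)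

lemma act_add:
  assumes x: "x \<in> space M"
  shows "act (p + q) x = act p (act q x)"
proof -
  have T_space: "T x \<in> space M" if "x \<in> space M" for x
    using measurable_space[OF imp_measurable[OF T] that] .
  have "T (int_iterate M S i x) = int_iterate M S i (T x)" if "x \<in> space M" for i x
    using int_iterate_commute[where g = T, OF S T_space commute that] by simp
  then have "int_iterate M T j (int_iterate M S i x) = int_iterate M S i (int_iterate M T j x)"
    if "x \<in> space M" for i j x
    using int_iterate_commute[where g = "int_iterate M S i", OF T int_iterate_space[OF S] _ that] that
    by simp
  then show ?thesis
    by (simp add: Z2_act_def int_iterate_add[OF S] int_iterate_add[OF T]
        int_iterate_space[OF S] int_iterate_space[OF T] x)
qed

lemma act_distr: "distr M M (act p) = M"
  using distr_distr[OF int_iterate_measurable[OF S] int_iterate_measurable[OF T], of "snd p" "fst p"]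
  by (simp add: Z2_act_def int_iterate_distr[OF S] int_iterate_distr[OF T])

text \<open>The two coordinate bounds are linear in \<open>n\<close>, and their product is
  comparable with \<open>n * n\<close>, the size of \<open>F n\<close>.\<close>

lemma F_doubling:
  obtains K :: real where "K \<ge> 0" "\<And>n. real (card (difference_set (F n))) \<le> K * real (card (F n))"
proof -
  obtain K1 where K1: "\<And>n. card (difference_set (s ` {1..n})) \<le> K1 * n"
    by (rule sb.card_difference_set_initial) auto
  obtain K2 where K2: "\<And>n. card (difference_set (t ` {1..n})) \<le> K2 * n"
    by (rule tb.card_difference_set_initial) auto
  show thesis
  proof (rule that[of "real (K1 * K2)"])
    fix n
    have "difference_set (F n) \<subseteq> difference_set (s ` {1..n}) \<times> difference_set (t ` {1..n})"
      unfolding F_def by (rule difference_set_Times_subset)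
    then have "card (difference_set (F n)) \<le> card (difference_set (s ` {1..n}) \<times> difference_set (t ` {1..n}))"
      by (intro card_mono) (auto intro!: finite_difference_set)
    also have "\<dots> \<le> (K1 * n) * (K2 * n)"
      unfolding card_cartesian_product by (intro mult_mono K1 K2) auto
    also have "\<dots> = (K1 * K2) * card (F n)" by (simp add: card_F)
    finally show "real (card (difference_set (F n))) \<le> real (K1 * K2) * real (card (F n))"
      by (simp only: of_nat_mult[symmetric] of_nat_le_iff)
  qed simp
qed

lemma F_folner: "(\<lambda>n. real (card (F n - (+) p ` F n)) / real (card (F n))) \<longlonglongrightarrow> 0"
proof (cases p)
  case (Pair i j)
  let ?ds = "\<lambda>n. card (s ` {1..n} - (+) i ` s ` {1..n})"
  let ?dt = "\<lambda>n. card (t ` {1..n} - (+) j ` t ` {1..n})"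
  have "norm (real (card (F n - (+) p ` F n)) / real (card (F n))) \<le> ?ds n / n + ?dt n / n" for n
  proof (cases "n = 0")
    case False
    have "card (F n - (+) p ` F n) \<le> card ((s ` {1..n} - (+) i ` s ` {1..n}) \<times> t ` {1..n}
        \<union> s ` {1..n} \<times> (t ` {1..n} - (+) j ` t ` {1..n}))"
      unfolding F_def Pair by (intro card_mono Times_diff_shift_subset finite_UnI finite_cartesian_product) simp_all
    also have "\<dots> \<le> card ((s ` {1..n} - (+) i ` s ` {1..n}) \<times> t ` {1..n})
        + card (s ` {1..n} \<times> (t ` {1..n} - (+) j ` t ` {1..n}))"
      by (rule card_Un_le)
    also have "\<dots> = ?ds n * n + n * ?dt n"
      by (simp only: card_cartesian_product sb.card_initial tb.card_initial)
    finally have "real (card (F n - (+) p ` F n)) \<le> real (?ds n * n + n * ?dt n)"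
      by (simp only: of_nat_le_iff)
    then have "real (card (F n - (+) p ` F n)) / (real n * real n) \<le> real (?ds n * n + n * ?dt n) / (real n * real n)"
      by (rule divide_right_mono) simp
    also have "\<dots> = ?ds n / n + ?dt n / n"
      using False by (simp add: add_divide_distrib)
    finally show ?thesis by (simp add: card_F)
  qed (simp add: card_F)
  then have "\<forall>\<^sub>F n in sequentially.
      norm (real (card (F n - (+) p ` F n)) / real (card (F n))) \<le> ?ds n / n + ?dt n / n"
    by (intro always_eventually allI)
  moreover have "(\<lambda>n. ?ds n / n + ?dt n / n) \<longlonglongrightarrow> 0"
    using tendsto_add[OF sb.folner_initial tb.folner_initial] by simp
  ultimately show ?thesis by (rule Lim_null_comparison)
qed

lemma Z2_averages_doubling:
  assumes "K \<ge> 0" "\<And>n. real (card (difference_set (F n))) \<le> K * real (card (F n))"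
  shows "Z2_averages M act F K"
proof
  show "act p \<in> measurable M M" for p
    unfolding Z2_act_def
    by (rule measurable_comp[OF int_iterate_measurable[OF T] int_iterate_measurable[OF S]])
  show "mono F" unfolding F_def by (intro monoI Sigma_mono image_mono) auto
qed (use assms act_distr act_add in \<open>auto simp: F_def\<close>)

text \<open>Since \<open>s\<close> and \<open>t\<close> are injective on the indices, the double sum
  visits each point of \<open>F n\<close> exactly once. For \<open>n = 0\<close> both sides are
  0.\<close>

lemma double_average_eq:
  "double_average M S T s t n n f x = (1 / real (card (F n))) *\<^sub>R (\<Sum>p\<in>F n. f (act p x))"
proof -
  have "(\<Sum>p\<in>F n. f (act p x)) = (\<Sum>i\<in>s ` {1..n}. \<Sum>j\<in>t ` {1..n}. f (act (i, j) x))"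
    by (simp add: F_def sum.cartesian_product)
  also have "\<dots> = (\<Sum>i=1..n. \<Sum>j=1..n. f (act (s i, t j) x))"
    by (simp only: sum.reindex[OF sb.s_inj] sum.reindex[OF tb.s_inj] comp_def)
  finally show ?thesis
    by (simp only: double_average_def card_F of_nat_mult Z2_act_def comp_def fst_conv snd_conv)
qed

end

section \<open>Weak and strong bounds and convergence for the square averages\<close>

context commuting_block_averages
begin

context
  fixes K :: real
  assumes K: "K \<ge> 0" "\<And>n. real (card (difference_set (F n))) \<le> K * real (card (F n))"
begin

interpretation Z2_averages M act F K by (rule Z2_averages_doubling[OF K])

text \<open>Passes from vector-valued functions to their norms, to which the maximal inequality for
  nonnegative functions applies.\<close>

lemma norm_double_average_le: "norm (double_average M S T s t n n f x) \<le> avg n (\<lambda>x. norm (f x)) x"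
  unfolding double_average_eq avg_def
  by (simp add: divide_inverse mult.commute mult_left_mono norm_sum)

lemma square_maximal_le:
  "square_maximal M S T s t f x \<le> (SUP n. ennreal (avg n (\<lambda>x. norm (f x)) x))"
  unfolding square_maximal_def
proof (rule SUP_least)
  fix n
  have "ennreal (norm (double_average M S T s t n n f x)) \<le> ennreal (avg n (\<lambda>x. norm (f x)) x)"
    by (intro ennreal_leI norm_double_average_le)
  also have "\<dots> \<le> (SUP n. ennreal (avg n (\<lambda>x. norm (f x)) x))"
    by (intro SUP_upper) simp
  finally show "ennreal (norm (double_average M S T s t n n f x)) \<le> \<dots>" .
qed

lemma square_maximal_weak_type:
  "weak_type_1_1 M (square_maximal M S T s t :: ('a \<Rightarrow> 'b::{real_normed_vector, second_countable_topology}) \<Rightarrow> 'a \<Rightarrow> ennreal)"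
  unfolding weak_type_1_1_def
proof (intro exI[of _ "4 * K"] ballI allI impI)
  fix f :: "'a \<Rightarrow> 'b" and l :: real
  assume f: "f \<in> Lp_functions M 1" and l: "l > 0"
  have int: "integrable M (\<lambda>x. norm (f x))" using Lp_functions_integrable[OF f] by simp
  note [measurable] = borel_measurable_integrable[OF int]
  let ?B = "{x \<in> space M. \<exists>n. avg n (\<lambda>x. norm (f x)) x > l}"
  have "{x \<in> space M. square_maximal M S T s t f x > ennreal l} \<subseteq> ?B"
  proof safe
    fix x assume "square_maximal M S T s t f x > ennreal l"
    also note square_maximal_le
    finally obtain n where "ennreal (avg n (\<lambda>x. norm (f x)) x) > ennreal l" by (auto simp: less_SUP_iff)
    then show "\<exists>n. avg n (\<lambda>x. norm (f x)) x > l" using l by (auto simp: ennreal_less_iff)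
  qed
  then have "emeasure M {x \<in> space M. square_maximal M S T s t f x > ennreal l} \<le> emeasure M ?B"
    by (intro emeasure_mono) measurable
  also have "\<dots> = ennreal (measure M ?B)" by (rule emeasure_eq_measure)
  also have "\<dots> \<le> ennreal (4 * K / l * (LINT x|M. norm (f x)))"
    by (intro ennreal_leI maximal_inequality int l) simp
  also have "\<dots> = ennreal (4 * K / l) * Lp_norm M 1 (\<lambda>x. ennreal (norm (f x)))"
    using K(1) l ennreal_mult[of "4 * K / l" "LINT x|M. norm (f x)"]
    by (simp add: Lp_norm_1 nn_integral_eq_integral[OF int])
  finally show "emeasure M {x \<in> space M. square_maximal M S T s t f x > ennreal l}
      \<le> ennreal (4 * K / l) * Lp_norm M 1 (\<lambda>x. ennreal (norm (f x)))" .
qed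

lemma square_maximal_strong_type:
  assumes p: "p > 1"
  shows "strong_type M p (square_maximal M S T s t :: ('a \<Rightarrow> 'b::{real_normed_vector, second_countable_topology}) \<Rightarrow> 'a \<Rightarrow> ennreal)"
  unfolding strong_type_def
proof (intro exI ballI)
  fix f :: "'a \<Rightarrow> 'b"
  assume f: "f \<in> Lp_functions M p"
  define D where "D = 8 * K * p / (p - 1) * 2 powr (p - 1)"
  have D: "D \<ge> 0" using K(1) p by (simp add: D_def)
  have int: "integrable M (\<lambda>x. norm (f x))" using Lp_functions_integrable[OF f] p by simp
  \<comment> \<open>Membership in \<open>L\<^sup>p\<close> makes the integral a real number, so that
    the \<open>p\<close>-th root can be taken of a product of reals.\<close>
  obtain r where r: "r \<ge> 0" "(\<integral>\<^sup>+x. ennreal (norm (f x) powr p) \<partial>M) = ennreal r"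
    using f p by (cases "\<integral>\<^sup>+x. ennreal (norm (f x) powr p) \<partial>M") (auto simp: Lp_functions_iff)
  have "(\<integral>\<^sup>+x. ennreal_powr (square_maximal M S T s t f x) p \<partial>M)
      \<le> (\<integral>\<^sup>+x. ennreal_powr (SUP n. ennreal (avg n (\<lambda>x. norm (f x)) x)) p \<partial>M)"
    using p by (intro nn_integral_mono ennreal_powr_mono square_maximal_le) auto
  also have "\<dots> \<le> ennreal D * ennreal r"
    using maximal_strong_type[OF int _ p] by (simp add: D_def r)
  finally have "Lp_norm M p (square_maximal M S T s t f) \<le> ennreal_powr (ennreal D * ennreal r) (1 / p)"
    unfolding Lp_norm_def using p by (intro ennreal_powr_mono) auto
  also have "\<dots> = ennreal (D powr (1 / p)) * ennreal (r powr (1 / p))"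
    using D r by (simp add: ennreal_mult[symmetric] ennreal_powr_ennreal powr_mult)
  also have "ennreal (r powr (1 / p)) = Lp_norm M p (\<lambda>x. ennreal (norm (f x)))"
    using r by (simp add: Lp_norm_def ennreal_powr_ennreal)
  finally show "Lp_norm M p (square_maximal M S T s t f)
      \<le> ennreal ((8 * K * p / (p - 1) * 2 powr (p - 1)) powr (1 / p)) * Lp_norm M p (\<lambda>x. ennreal (norm (f x)))"
    by (simp only: D_def)
qed

text \<open>The real-valued theorem is applied to the real and imaginary parts separately.\<close>

lemma double_average_tendsto:
  fixes f :: "'a \<Rightarrow> complex"
  assumes erg: "ergodic_Z2_action M S T" and f: "f \<in> Lp_functions M 1"
  shows "AE x in M. (\<lambda>n. double_average M S T s t n n f x) \<longlonglongrightarrow> (LINT y|M. f y)"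
proof -
  interpret Z2_ergodic_folner_averages M act F K
  proof
    show "F n \<noteq> {}" if "n \<ge> 1" for n using that by (auto simp: F_def)
    show "measure M A = 0 \<or> measure M A = 1"
      if "A \<in> sets M" "\<And>p. act p -` A \<inter> space M = A" for A
      using erg that(1) that(2)[of "(i, j)" for i j]
      unfolding ergodic_Z2_action_def Z2_act_def by simp
  qed (rule F_folner)
  have "f \<in> borel_measurable M" using f by (simp add: Lp_functions_def)
  then have int: "integrable M f"
    using Lp_functions_integrable[OF f] by (simp add: integrable_norm_iff)
  have Re: "Re (double_average M S T s t n n f x) = avg n (\<lambda>x. Re (f x)) x"
    and Im: "Im (double_average M S T s t n n f x) = avg n (\<lambda>x. Im (f x)) x" for n x
    by (simp_all add: double_average_eq avg_def)
  have "AE x in M. (\<lambda>n. avg n (\<lambda>x. Re (f x)) x) \<longlonglongrightarrow> (LINT x|M. Re (f x))"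
    "AE x in M. (\<lambda>n. avg n (\<lambda>x. Im (f x)) x) \<longlonglongrightarrow> (LINT x|M. Im (f x))"
    by (rule avg_tendsto_integral[OF integrable_Re[OF int]],
        rule avg_tendsto_integral[OF integrable_Im[OF int]])
  then show ?thesis
    by eventually_elim (simp add: tendsto_complex_iff Re Im integral_Re[OF int] integral_Im[OF int])
qed

end

end

theorem proposition2p3:
  fixes M :: "'a measure"
    and S T :: "'a \<Rightarrow> 'a"
    and a b :: "nat \<Rightarrow> nat"
    and u v s t :: "nat \<Rightarrow> int"
    and C :: real
  assumes "\<And>k. k \<ge> 1 \<Longrightarrow> a k > 0"
    and "\<And>k. k \<ge> 1 \<Longrightarrow> b k > 0"
    and "\<And>k. k \<ge> 1 \<Longrightarrow> u (k + 1) \<ge> u k + int (a k)"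
    and "\<And>k. k \<ge> 1 \<Longrightarrow> v (k + 1) \<ge> v k + int (b k)"
    and "(\<lambda>k. (1 / real (a k)) * (\<Sum>i=1..k-1. real (a i))) \<longlonglongrightarrow> 0"
    and "(\<lambda>k. (1 / real (b k)) * (\<Sum>j=1..k-1. real (b j))) \<longlonglongrightarrow> 0"
    and "C > 0"
    and "\<And>k. k \<ge> 2 \<Longrightarrow> real (a k) \<ge> C * real_of_int (u (k - 1))"
    and "\<And>k. k \<ge> 2 \<Longrightarrow> real (b k) \<ge> C * real_of_int (v (k - 1))"
    and "increasing_enumeration s (block_union u a)"
    and "increasing_enumeration t (block_union v b)"
    and "prob_space M"
    and "invertible_measure_preserving M S"
    and "invertible_measure_preserving M T"
    and "\<And>x. x \<in> space M \<Longrightarrow> S (T x) = T (S x)"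
  shows "weak_type_1_1 M (square_maximal M S T s t :: ('a \<Rightarrow> complex) \<Rightarrow> 'a \<Rightarrow> ennreal)
    \<and> (\<forall>p>1. strong_type M p (square_maximal M S T s t :: ('a \<Rightarrow> complex) \<Rightarrow> 'a \<Rightarrow> ennreal))
    \<and> (ergodic_Z2_action M S T \<longrightarrow>
         (\<forall>f :: 'a \<Rightarrow> complex. f \<in> Lp_functions M 1 \<longrightarrow>
            (AE x in M. (\<lambda>n. double_average M S T s t n n f x)
               \<longlonglongrightarrow> (LINT y|M. f y))))"
proof -
  interpret prob_space M by fact
  interpret commuting_block_averages M S T a b u v s t C
    by unfold_locales fact+
  obtain K :: real where K: "K \<ge> 0" "\<And>n. real (card (difference_set (F n))) \<le> K * real (card (F n))"
    by (rule F_doubling) auto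
  show ?thesis
    by (intro conjI allI impI square_maximal_weak_type[OF K] square_maximal_strong_type[OF K]
        double_average_tendsto[OF K])
qed

end
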